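(* There is a $\Pi_2$-axiomatizable class $\mathbb{K}$ of structures such that the set of structures in $\mathbb{K}$ (with universe $\omega$) having a $\Sigma_1$-generically c.e. copy is $\mathbf{\Sigma}^1_1$-complete.
   Context: A class is $\Pi_2$-axiomatizable if it is the class of models (in some fixed countable language) of a collection of $\Pi_2$ sentences. The structures with universe $\omega$ in a fixed countable language form a Polish space in the usual way; a set of such structures is $\mathbf{\Sigma}^1_1$-complete if it is (boldface) $\mathbf{\Sigma}^1_1$ and every $\mathbf{\Sigma}^1_1$ subset of Baire space is reducible to it by a continuous function (here with values in the set of members of $\mathbb{K}$ with universe $\omega$). Structures are countable with universe $\omega$ (substructures have universe a subset of $\omega$). A copy of a structure is a structure with universe $\omega$ isomorphic to it. Formulas are infinitary formulas of $\mathcal{L}_{\omega_1,\omega}$: $\Sigma_0=\Pi_0$ are the finitary quantifier-free formulas, and for $\alpha\ge 1$ a $\Sigma_\alpha$ formula is a countable disjunction of formulas $\exists \bar x\,\psi$ with $\psi\in\Pi_\beta$, $\beta<\alpha$ (dually for $\Pi_\alpha$). A substructure $\mathcal{B}$ of $\mathcal{A}$ is a $\Sigma_\alpha$ elementary substructure if for every $\Sigma_\alpha$ formula $\phi$ and every tuple $\bar b$ from $\mathcal{B}$, $\mathcal{B}\models\phi(\bar b)\iff\mathcal{A}\models\phi(\bar b)$. A set $D\subseteq\omega$ is dense if $\lim_{n\to\infty}|D\cap\{0,\dots,n\}|/(n+1)=1$. A c.e. substructure is one whose universe is c.e., each of whose relations (restricted to that universe) is c.e., and each of whose functions has c.e.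 graph. $\mathcal{A}$ is $\Sigma_\alpha$-generically c.e. if there is a dense c.e. set $D$ such that the substructure of $\mathcal{A}$ with universe $D$ is a c.e. substructure and a $\Sigma_\alpha$ elementary substructure of $\mathcal{A}$. *)

theory Defs
  imports "HOL-Analysis.Analysis"
begin

section \<open>Languages and structures with universe \<open>\<omega>\<close>\<close>

text \<open>Symbols are named by natural numbers, so every language is countable; constants are the
  function symbols of arity 0.\<close>

record language =
  rels :: "nat set"
  funs :: "nat set"
  rel_arity :: "nat \<Rightarrow> nat"
  fun_arity :: "nat \<Rightarrow> nat"

text \<open>A structure with universe \<open>\<omega>\<close> interprets the relation symbols (first component) and the function
  symbols (second component) on tuples, which are lists. The type carries the product topology over
  discrete \<^typ>\<open>bool\<close> and \<^typ>\<open>nat\<close>.\<close>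

type_synonym struct = "(nat \<Rightarrow> nat list \<Rightarrow> bool) \<times> (nat \<Rightarrow> nat list \<Rightarrow> nat)"

text \<open>Interpretations are given a default value off the language, so that a structure is
  determined by its interpretation of the symbols of \<open>L\<close>. As a closed subspace of \<^typ>\<open>struct\<close>
  this set is the usual Polish space, the product of a copy of the space of subsets of
  \<open>\<omega>\<^sup>n\<close> for each \<open>n\<close>-ary relation symbol
  and of a copy of the space of functions from \<open>\<omega>\<^sup>n\<close> to \<open>\<omega>\<close> for each \<open>n\<close>-ary function symbol.\<close>

definition structures :: "language \<Rightarrow> struct set" where
  "structures L = {A.
     (\<forall>R xs. R \<notin> rels L \<or> length xs \<noteq> rel_arity L R \<longrightarrow> \<not> fst A R xs) \<and>
     (\<forall>F xs. F \<notin> funs L \<or> length xs \<noteq> fun_arity L F \<longrightarrow> snd A F xs = 0)}"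

lemma closed_structures: "closed (structures L)"
proof -
  have fst_cont: "continuous_on UNIV (\<lambda>A::struct. fst A R xs)" for R xs
    by (rule continuous_on_product_then_coordinatewise)
      (rule continuous_on_product_then_coordinatewise, rule continuous_on_fst[OF continuous_on_id])
  have snd_cont: "continuous_on UNIV (\<lambda>A::struct. snd A F xs)" for F xs
    by (rule continuous_on_product_then_coordinatewise)
      (rule continuous_on_product_then_coordinatewise, rule continuous_on_snd[OF continuous_on_id])
  have "closed {A::struct. fst A R xs = False}" for R xs
    by (rule closed_Collect_eq[OF fst_cont continuous_on_const])
  then have 1: "closed {A::struct. P \<longrightarrow> \<not> fst A R xs}" for P R xs
    by (cases P) auto
  have "closed {A::struct. snd A F xs = 0}" for F xs
    by (rule closed_Collect_eq[OF snd_cont continuous_on_const])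
  then have 2: "closed {A::struct. P \<longrightarrow> snd A F xs = 0}" for P F xs
    by (cases P) auto
  show ?thesis
    unfolding structures_def by (intro closed_Collect_conj closed_Collect_all 1 2)
qed

definition isomorphic :: "language \<Rightarrow> struct \<Rightarrow> struct \<Rightarrow> bool" where
  "isomorphic L A B \<longleftrightarrow> (\<exists>h::nat \<Rightarrow> nat. bij h \<and>
     (\<forall>R\<in>rels L. \<forall>xs. length xs = rel_arity L R \<longrightarrow> (fst A R xs \<longleftrightarrow> fst B R (map h xs))) \<and>
     (\<forall>F\<in>funs L. \<forall>xs. length xs = fun_arity L F \<longrightarrow> h (snd A F xs) = snd B F (map h xs)))"

definition is_copy :: "language \<Rightarrow> struct \<Rightarrow> struct \<Rightarrow> bool" where
  "is_copy L A B \<longleftrightarrow> B \<in> structures L \<and> isomorphic L A B"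

definition substructure_on :: "language \<Rightarrow> struct \<Rightarrow> nat set \<Rightarrow> bool" where
  "substructure_on L A D \<longleftrightarrow> D \<noteq> {} \<and>
     (\<forall>F\<in>funs L. \<forall>xs. length xs = fun_arity L F \<longrightarrow> set xs \<subseteq> D \<longrightarrow> snd A F xs \<in> D)"


section \<open>Infinitary formulas\<close>

datatype tm = Var nat | App nat "tm list"

text \<open>In \<open>Disj I f\<close> and \<open>Conj I f\<close> only the formulas \<open>f i\<close> with \<open>i \<in> I\<close> matter, so finite and
  empty disjunctions and conjunctions are included.\<close>

datatype fm =
    Eq tm tm
  | Rel nat "tm list"
  | Neg fm
  | And fm fm
  | Or fm fm
  | Ex nat fm
  | All nat fm
  | Disj "nat set" "nat \<Rightarrow> fm"
  | Conj "nat set" "nat \<Rightarrow> fm"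

fun fv_tm :: "tm \<Rightarrow> nat set" where
  "fv_tm (Var x) = {x}"
| "fv_tm (App F ts) = (\<Union>t\<in>set ts. fv_tm t)"

primrec fv :: "fm \<Rightarrow> nat set" where
  "fv (Eq t u) = fv_tm t \<union> fv_tm u"
| "fv (Rel R ts) = (\<Union>t\<in>set ts. fv_tm t)"
| "fv (Neg \<phi>) = fv \<phi>"
| "fv (And \<phi> \<psi>) = fv \<phi> \<union> fv \<psi>"
| "fv (Or \<phi> \<psi>) = fv \<phi> \<union> fv \<psi>"
| "fv (Ex x \<phi>) = fv \<phi> - {x}"
| "fv (All x \<phi>) = fv \<phi> - {x}"
| "fv (Disj I f) = (\<Union>i\<in>I. fv (f i))"
| "fv (Conj I f) = (\<Union>i\<in>I. fv (f i))"

fun wf_tm :: "language \<Rightarrow> tm \<Rightarrow> bool" where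
  "wf_tm L (Var x) \<longleftrightarrow> True"
| "wf_tm L (App F ts) \<longleftrightarrow> F \<in> funs L \<and> length ts = fun_arity L F \<and> (\<forall>t\<in>set ts. wf_tm L t)"

primrec wf_fm :: "language \<Rightarrow> fm \<Rightarrow> bool" where
  "wf_fm L (Eq t u) \<longleftrightarrow> wf_tm L t \<and> wf_tm L u"
| "wf_fm L (Rel R ts) \<longleftrightarrow> R \<in> rels L \<and> length ts = rel_arity L R \<and> (\<forall>t\<in>set ts. wf_tm L t)"
| "wf_fm L (Neg \<phi>) \<longleftrightarrow> wf_fm L \<phi>"
| "wf_fm L (And \<phi> \<psi>) \<longleftrightarrow> wf_fm L \<phi> \<and> wf_fm L \<psi>"
| "wf_fm L (Or \<phi> \<psi>) \<longleftrightarrow> wf_fm L \<phi> \<and> wf_fm L \<psi>"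
| "wf_fm L (Ex x \<phi>) \<longleftrightarrow> wf_fm L \<phi>"
| "wf_fm L (All x \<phi>) \<longleftrightarrow> wf_fm L \<phi>"
| "wf_fm L (Disj I f) \<longleftrightarrow> (\<forall>i\<in>I. wf_fm L (f i))"
| "wf_fm L (Conj I f) \<longleftrightarrow> (\<forall>i\<in>I. wf_fm L (f i))"

fun eval_tm :: "struct \<Rightarrow> (nat \<Rightarrow> nat) \<Rightarrow> tm \<Rightarrow> nat" where
  "eval_tm A s (Var x) = s x"
| "eval_tm A s (App F ts) = snd A F (map (eval_tm A s) ts)"

text \<open>Satisfaction in the substructure of \<open>A\<close> with universe \<open>D\<close>; \<open>D = UNIV\<close> gives satisfaction
  in \<open>A\<close>.\<close>

primrec sat :: "struct \<Rightarrow> nat set \<Rightarrow> (nat \<Rightarrow> nat) \<Rightarrow> fm \<Rightarrow> bool" where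
  "sat A D s (Eq t u) \<longleftrightarrow> eval_tm A s t = eval_tm A s u"
| "sat A D s (Rel R ts) \<longleftrightarrow> fst A R (map (eval_tm A s) ts)"
| "sat A D s (Neg \<phi>) \<longleftrightarrow> \<not> sat A D s \<phi>"
| "sat A D s (And \<phi> \<psi>) \<longleftrightarrow> sat A D s \<phi> \<and> sat A D s \<psi>"
| "sat A D s (Or \<phi> \<psi>) \<longleftrightarrow> sat A D s \<phi> \<or> sat A D s \<psi>"
| "sat A D s (Ex x \<phi>) \<longleftrightarrow> (\<exists>a\<in>D. sat A D (s(x := a)) \<phi>)"
| "sat A D s (All x \<phi>) \<longleftrightarrow> (\<forall>a\<in>D. sat A D (s(x := a)) \<phi>)"
| "sat A D s (Disj I f) \<longleftrightarrow> (\<exists>i\<in>I. sat A D s (f i))"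
| "sat A D s (Conj I f) \<longleftrightarrow> (\<forall>i\<in>I. sat A D s (f i))"

inductive quantifier_free :: "fm \<Rightarrow> bool" where
  "quantifier_free (Eq t u)"
| "quantifier_free (Rel R ts)"
| "quantifier_free \<phi> \<Longrightarrow> quantifier_free (Neg \<phi>)"
| "quantifier_free \<phi> \<Longrightarrow> quantifier_free \<psi> \<Longrightarrow> quantifier_free (And \<phi> \<psi>)"
| "quantifier_free \<phi> \<Longrightarrow> quantifier_free \<psi> \<Longrightarrow> quantifier_free (Or \<phi> \<psi>)"

text \<open>The finite levels of the hierarchy; \<open>foldr Ex xs \<psi>\<close> is \<open>\<exists>xs. \<psi>\<close> for the finite tuple \<open>xs\<close>.\<close>

inductive Sigma_fm :: "nat \<Rightarrow> fm \<Rightarrow> bool" and Pi_fm :: "nat \<Rightarrow> fm \<Rightarrow> bool" where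
  Sigma_0: "quantifier_free \<phi> \<Longrightarrow> Sigma_fm 0 \<phi>"
| Pi_0: "quantifier_free \<phi> \<Longrightarrow> Pi_fm 0 \<phi>"
| Sigma_pos: "n \<ge> 1 \<Longrightarrow> \<forall>i\<in>I. \<exists>m<n. \<exists>xs \<psi>. f i = foldr Ex xs \<psi> \<and> Pi_fm m \<psi> \<Longrightarrow>
    Sigma_fm n (Disj I f)"
| Pi_pos: "n \<ge> 1 \<Longrightarrow> \<forall>i\<in>I. \<exists>m<n. \<exists>xs \<psi>. f i = foldr All xs \<psi> \<and> Sigma_fm m \<psi> \<Longrightarrow>
    Pi_fm n (Conj I f)"

definition Pi_axiomatizable :: "language \<Rightarrow> nat \<Rightarrow> struct set \<Rightarrow> bool" where
  "Pi_axiomatizable L n K \<longleftrightarrow> (\<exists>T.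
     (\<forall>\<phi>\<in>T. Pi_fm n \<phi> \<and> wf_fm L \<phi> \<and> fv \<phi> = {}) \<and>
     K = {A \<in> structures L. \<forall>\<phi>\<in>T. \<forall>s. sat A UNIV s \<phi>})"

text \<open>The assignment \<open>s\<close>, restricted to the finitely many free variables of \<open>\<phi>\<close>, is a tuple
  from \<open>D\<close>.\<close>

definition Sigma_elementary :: "language \<Rightarrow> nat \<Rightarrow> struct \<Rightarrow> nat set \<Rightarrow> bool" where
  "Sigma_elementary L n A D \<longleftrightarrow> substructure_on L A D \<and>
     (\<forall>\<phi> s. Sigma_fm n \<phi> \<and> wf_fm L \<phi> \<and> finite (fv \<phi>) \<and> s ` fv \<phi> \<subseteq> D \<longrightarrow>
        (sat A D s \<phi> \<longleftrightarrow> sat A UNIV s \<phi>))"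


section \<open>Computably enumerable substructures\<close>

text \<open>Kleene's partial recursive functions. A code has no fixed arity: \<open>computes f xs y\<close> says
  that \<open>f\<close>, read as a function of \<open>length xs\<close> arguments, converges on \<open>xs\<close> with value \<open>y\<close>.\<close>

datatype recf = Zero | Succ | Proj nat | Comp recf "recf list" | PrimRec recf recf | Mu recf

inductive computes :: "recf \<Rightarrow> nat list \<Rightarrow> nat \<Rightarrow> bool" where
  "computes Zero xs 0"
| "computes Succ [x] (Suc x)"
| "i < length xs \<Longrightarrow> computes (Proj i) xs (xs ! i)"
| "list_all2 (\<lambda>g y. computes g xs y) gs ys \<Longrightarrow> computes f ys z \<Longrightarrow> computes (Comp f gs) xs z"
| "computes f xs y \<Longrightarrow> computes (PrimRec f g) (0 # xs) y"
| "computes (PrimRec f g) (n # xs) y \<Longrightarrow> computes g (n # y # xs) z \<Longrightarrow>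
    computes (PrimRec f g) (Suc n # xs) z"
| "computes f (n # xs) 0 \<Longrightarrow> \<forall>m<n. \<exists>y>0. computes f (m # xs) y \<Longrightarrow> computes (Mu f) xs n"

text \<open>An \<open>n\<close>-ary relation is c.e. if it is the domain of an \<open>n\<close>-ary partial recursive function.\<close>

definition ce_rel :: "nat \<Rightarrow> nat list set \<Rightarrow> bool" where
  "ce_rel n X \<longleftrightarrow> (\<exists>f. X = {xs. length xs = n \<and> (\<exists>y. computes f xs y)})"

definition ce_set :: "nat set \<Rightarrow> bool" where
  "ce_set D \<longleftrightarrow> ce_rel 1 ((\<lambda>x. [x]) ` D)"

definition ce_substructure :: "language \<Rightarrow> struct \<Rightarrow> nat set \<Rightarrow> bool" where
  "ce_substructure L A D \<longleftrightarrow> substructure_on L A D \<and> ce_set D \<and>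
     (\<forall>R\<in>rels L. ce_rel (rel_arity L R)
        {xs. length xs = rel_arity L R \<and> set xs \<subseteq> D \<and> fst A R xs}) \<and>
     (\<forall>F\<in>funs L. ce_rel (Suc (fun_arity L F))
        {xs @ [snd A F xs] | xs. length xs = fun_arity L F \<and> set xs \<subseteq> D})"

definition dense_set :: "nat set \<Rightarrow> bool" where
  "dense_set D \<longleftrightarrow> (\<lambda>n. real (card (D \<inter> {0..n})) / real (n + 1)) \<longlonglongrightarrow> 1"

definition Sigma_generically_ce :: "language \<Rightarrow> nat \<Rightarrow> struct \<Rightarrow> bool" where
  "Sigma_generically_ce L n A \<longleftrightarrow>
     (\<exists>D. dense_set D \<and> ce_substructure L A D \<and> Sigma_elementary L n A D)"


section \<open>Completeness for boldface \<open>\<Sigma>\<^sup>1\<^sub>1\<close>\<close>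

text \<open>Projections of closed sets along Baire space, which is \<^typ>\<open>nat \<Rightarrow> nat\<close> with the product
  topology. Since \<^const>\<open>structures\<close> is closed in \<^typ>\<open>struct\<close>, it makes no difference
  whether this is taken in the type or in that subspace.\<close>

definition analytic_set :: "'a::topological_space set \<Rightarrow> bool" where
  "analytic_set S \<longleftrightarrow> (\<exists>C :: ('a \<times> (nat \<Rightarrow> nat)) set. closed C \<and> S = fst ` C)"

text \<open>The reductions take values in \<open>K\<close>.\<close>

definition Sigma11_complete_within :: "'a::topological_space set \<Rightarrow> 'a set \<Rightarrow> bool" where
  "Sigma11_complete_within K S \<longleftrightarrow> analytic_set S \<and>
     (\<forall>P :: (nat \<Rightarrow> nat) set. analytic_set P \<longrightarrow>
        (\<exists>f. continuous_on UNIV f \<and> range f \<subseteq> K \<and> (\<forall>x. x \<in> P \<longleftrightarrow> f x \<in> S)))"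

end

theory Submission
  imports Defs "HOL-Real_Asymp.Real_Asymp"
begin

text \<open>
  The class \<open>\<bbbK>\<close> consists of all structures in a language with two binary relations, so its set of
  axioms is empty and all the content is in the structures that the reduction produces.

  \<^emph>\<open>The set is analytic\<close> for every countable language
  (\<open>analytic_generically_ce_copy\<close>): guess the copy, the isomorphism and the dense set. What remains to be
  checked is a combination of quantifiers over countable sets, because there are countably many programs, and because
  \<open>\<Sigma>\<^sub>1\<close> elementarity only has to be tested on the countably many formulas
  that consist of a finite string of existential quantifiers and a finitary quantifier-free matrix.

  \<^emph>\<open>The set is hard.\<close> Let \<open>P\<close> be the projection of a closed set \<open>C\<close>. Fix
  on the natural numbers one tree of infinite height in which each node has infinitely many children, each of them
  carrying a natural number, and each number being carried by infinitely many of them. A structure is this tree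
  together with a label, \<open>0\<close> or \<open>1\<close>, for each node; the two relations say that a node is a
  child of another one with label \<open>0\<close> or with label \<open>1\<close>. Given \<open>x\<close>, a node is
  \<^emph>\<open>good\<close> if the numbers on the way down to it agree with the second component of an element of
  \<open>C\<close> whose first component agrees with \<open>x\<close> up to that length. So \<open>x \<in> P\<close>
  if and only if there is an infinite branch of good nodes. Among the good children of a node that carry the same
  number, each label occurs infinitely often, independently of \<open>x\<close>, whereas the label of a bad node of
  depth \<open>n\<close> says whether \<open>n \<in> X\<close>, for a fixed set \<open>X\<close>.

  If there is a good branch \<open>g\<close>, the nodes whose numbers follow \<open>g\<close> form a copy of the full
  labelled tree, in which each node has infinitely many children with each label. The full labelled tree has a
  computable presentation on a dense set with infinite complement, and it is a \<open>\<Sigma>\<^sub>1\<close>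
  elementary substructure of each larger labelled tree, since finitely many further nodes can always be imitated by
  new nodes of the full tree (\<open>generically_ce_copy_if_tree_embedding\<close>).

  If there is no such branch, let \<open>D\<close> be the universe of a c.e. \<open>\<Sigma>\<^sub>1\<close>
  elementary substructure of a copy. Having a child is a \<open>\<Sigma>\<^sub>1\<close> property, so each node in
  \<open>D\<close> has a child in \<open>D\<close>. As descending through good nodes for ever is impossible,
  \<open>D\<close> contains a bad node. All its descendants are bad, and there is one in \<open>D\<close> at each
  greater depth, so that \<open>X\<close> can be read off, from some point on, from the c.e. relations on
  \<open>D\<close>. There are only countably many such relations, and \<open>X\<close> is chosen by diagonalization to
  differ from all sets that can be obtained in this way (\<open>path_if_generically_ce_copy\<close>).
\<close>

section \<open>Analytic sets\<close>

lemma continuous_on_comp_UNIV: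
  "continuous_on UNIV g \<Longrightarrow> continuous_on UNIV f \<Longrightarrow> continuous_on UNIV (\<lambda>x. g (f x))"
  by (rule continuous_on_compose2[of UNIV g]) auto

lemma continuous_on_coordinate: "continuous_on UNIV (\<lambda>z::'i \<Rightarrow> 'a::topological_space. z i)"
  by (rule continuous_on_product_then_coordinatewise) (rule continuous_on_id)

lemma closed_vimage_UNIV: "continuous_on UNIV f \<Longrightarrow> closed C \<Longrightarrow> closed {x. f x \<in> C}"
  using closed_vimage[of C f] by (simp add: vimage_def)

text \<open>The points of Baire space with a given finite prefix form an open set.\<close>

lemma continuous_if_prefix_determined:
  fixes f :: "(nat \<Rightarrow> nat) \<Rightarrow> 'b::topological_space"
  assumes "\<And>x x'. (\<And>i. i < n \<Longrightarrow> x i = x' i) \<Longrightarrow> f x = f x'"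
  shows "continuous_on UNIV f"
  unfolding continuous_on_open_vimage[OF open_UNIV]
proof (intro allI impI)
  fix B :: "'b set" assume "open B"
  have "\<exists>T. open T \<and> x \<in> T \<and> T \<subseteq> f -` B" if "x \<in> f -` B" for x
  proof (intro exI conjI)
    have "open {x' :: nat \<Rightarrow> nat. x' i = x i}" for i
      using open_vimage[OF open_discrete[of "{x i}"] continuous_on_coordinate[of i]]
      by (simp add: vimage_def)
    then have "open (\<Inter>i\<in>{..<n}. {x' :: nat \<Rightarrow> nat. x' i = x i})"
      by (intro open_INT) auto
    then show "open {x'. \<forall>i<n. x' i = x i}"
      by (simp add: INTER_eq Ball_def)
    show "{x'. \<forall>i<n. x' i = x i} \<subseteq> f -` B"
    proof
      fix x' assume "x' \<in> {x'. \<forall>i<n. x' i = x i}"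
      then have "f x' = f x" by (intro assms) auto
      with that show "x' \<in> f -` B" by simp
    qed
  qed auto
  then show "open (f -` B \<inter> UNIV)"
    using open_subopen[of "f -` B"] by auto
qed

lemma analytic_closed: "closed (S :: 'a::topological_space set) \<Longrightarrow> analytic_set S"
  unfolding analytic_set_def
  by (rule exI[of _ "S \<times> (UNIV :: (nat \<Rightarrow> nat) set)"]) (auto intro: closed_Times)

text \<open>Witnesses for all the sets are packed into the columns of a single point of Baire space.\<close>

lemma analytic_INT:
  fixes S :: "nat \<Rightarrow> 'a::topological_space set"
  assumes "\<And>n. analytic_set (S n)"
  shows "analytic_set (\<Inter>n. S n)"
proof -
  obtain C :: "nat \<Rightarrow> ('a \<times> (nat \<Rightarrow> nat)) set"
    where C: "\<And>n. closed (C n)" "\<And>n. S n = fst ` C n"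
    using assms unfolding analytic_set_def by metis
  define column where "column n z = (\<lambda>k. z (prod_encode (n, k)))" for n and z :: "nat \<Rightarrow> nat"
  define E where "E = {p. \<forall>n. (fst p, column n (snd p)) \<in> C n}"
  have "closed E"
    unfolding E_def column_def
    by (intro closed_Collect_all closed_vimage_UNIV C continuous_on_Pair continuous_on_fst
        continuous_on_id continuous_on_coordinatewise_then_product
        continuous_on_comp_UNIV[OF continuous_on_coordinate continuous_on_snd])
  moreover have "(\<Inter>n. S n) = fst ` E"
  proof
    show "fst ` E \<subseteq> (\<Inter>n. S n)"
      by (force simp: E_def C image_iff)
    show "(\<Inter>n. S n) \<subseteq> fst ` E"
    proof
      fix a assume "a \<in> (\<Inter>n. S n)"
      then have "\<forall>n. \<exists>z. (a, z) \<in> C n" by (force simp: C)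
      then obtain z where z: "\<And>n. (a, z n) \<in> C n" by metis
      define w where "w m = z (fst (prod_decode m)) (snd (prod_decode m))" for m
      have "column n w = z n" for n by (simp add: column_def w_def)
      with z have "(a, w) \<in> E" by (simp add: E_def)
      then show "a \<in> fst ` E" by force
    qed
  qed
  ultimately show ?thesis unfolding analytic_set_def by blast
qed

text \<open>The first entry of a witness tells which of the sets is meant.\<close>

lemma analytic_UN:
  fixes S :: "nat \<Rightarrow> 'a::topological_space set"
  assumes "\<And>n. analytic_set (S n)"
  shows "analytic_set (\<Union>n. S n)"
proof -
  obtain C :: "nat \<Rightarrow> ('a \<times> (nat \<Rightarrow> nat)) set"
    where C: "\<And>n. closed (C n)" "\<And>n. S n = fst ` C n"
    using assms unfolding analytic_set_def by metis
  define tail where "tail z = (\<lambda>k. z (Suc k))" for z :: "nat \<Rightarrow> nat"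
  define E where "E = {p. \<forall>n. snd p 0 \<in> - {n} \<or> (fst p, tail (snd p)) \<in> C n}"
  have "closed E"
    unfolding E_def tail_def
    by (intro closed_Collect_all closed_Collect_disj closed_vimage_UNIV C continuous_on_Pair
        continuous_on_fst continuous_on_id continuous_on_coordinatewise_then_product
        continuous_on_comp_UNIV[OF continuous_on_coordinate continuous_on_snd])
      (simp add: closed_def open_discrete)
  moreover have "(\<Union>n. S n) = fst ` E"
  proof
    show "fst ` E \<subseteq> (\<Union>n. S n)"
      by (force simp: E_def C image_iff)
    show "(\<Union>n. S n) \<subseteq> fst ` E"
    proof
      fix a assume "a \<in> (\<Union>n. S n)"
      then obtain n z where z: "(a, z) \<in> C n" by (force simp: C)
      have "(a, case_nat n z) \<in> E" using z by (simp add: E_def tail_def)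
      then show "a \<in> fst ` E" by force
    qed
  qed
  ultimately show ?thesis unfolding analytic_set_def by blast
qed

lemma analytic_vimage:
  fixes f :: "'a::topological_space \<Rightarrow> 'b::topological_space"
  assumes "analytic_set S" "continuous_on UNIV f"
  shows "analytic_set {a. f a \<in> S}"
proof -
  obtain C :: "('b \<times> (nat \<Rightarrow> nat)) set" where C: "closed C" "S = fst ` C"
    using assms(1) unfolding analytic_set_def by blast
  have "closed {p. (f (fst p), snd p) \<in> C}"
    by (intro closed_vimage_UNIV C continuous_on_Pair continuous_on_snd continuous_on_id
        continuous_on_comp_UNIV[OF assms(2) continuous_on_fst])
  moreover have "{a. f a \<in> S} = fst ` {p. (f (fst p), snd p) \<in> C}"
    by (force simp: C image_iff)
  ultimately show ?thesis unfolding analytic_set_def by blast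
qed

lemma analytic_projection:
  fixes dec :: "(nat \<Rightarrow> nat) \<Rightarrow> 'b::topological_space"
  assumes "analytic_set {p :: 'a::topological_space \<times> 'b. P (fst p) (snd p)}"
    and "continuous_on UNIV dec" and "surj dec"
  shows "analytic_set {a. \<exists>b. P a b}"
proof -
  have "analytic_set {p :: 'a \<times> (nat \<Rightarrow> nat). (fst p, dec (snd p)) \<in> {p. P (fst p) (snd p)}}"
    by (intro analytic_vimage assms(1) continuous_on_Pair continuous_on_fst continuous_on_id
        continuous_on_comp_UNIV[OF assms(2) continuous_on_snd])
  then obtain C :: "(('a \<times> (nat \<Rightarrow> nat)) \<times> (nat \<Rightarrow> nat)) set"
    where C: "closed C" "{p. P (fst p) (dec (snd p))} = fst ` C"
    unfolding analytic_set_def by auto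
  \<comment> \<open>The even entries code the projected variable, the odd entries the witness for \<open>P\<close>.\<close>
  define E where "E = {p :: 'a \<times> (nat \<Rightarrow> nat).
    ((fst p, \<lambda>k. snd p (2 * k)), \<lambda>k. snd p (2 * k + 1)) \<in> C}"
  have "closed E"
    unfolding E_def
    by (intro closed_vimage_UNIV C continuous_on_Pair continuous_on_fst continuous_on_id
        continuous_on_coordinatewise_then_product
        continuous_on_comp_UNIV[OF continuous_on_coordinate continuous_on_snd])
  moreover have "{a. \<exists>b. P a b} = fst ` E"
  proof
    show "fst ` E \<subseteq> {a. \<exists>b. P a b}"
    proof
      fix a assume "a \<in> fst ` E"
      then obtain z where "((a, \<lambda>k. z (2 * k)), \<lambda>k. z (2 * k + 1)) \<in> C"
        by (auto simp: E_def)
      then have "(a, \<lambda>k. z (2 * k)) \<in> {p. P (fst p) (dec (snd p))}"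
        unfolding C by (metis fst_conv image_eqI)
      then show "a \<in> {a. \<exists>b. P a b}" by auto
    qed
    show "{a. \<exists>b. P a b} \<subseteq> fst ` E"
    proof
      fix a assume "a \<in> {a. \<exists>b. P a b}"
      then obtain b where "P a b" by blast
      moreover obtain z where "b = dec z" using surjD[OF assms(3)] by blast
      ultimately have "P a (dec z)" by simp
      then have "(a, z) \<in> fst ` C" unfolding C(2)[symmetric] by simp
      then obtain w where w: "((a, z), w) \<in> C" by auto
      have "(a, \<lambda>k. if even k then z (k div 2) else w (k div 2)) \<in> E"
        using w by (simp add: E_def)
      then have "fst (a, \<lambda>k. if even k then z (k div 2) else w (k div 2)) \<in> fst ` E"
        by (rule imageI)
      then show "a \<in> fst ` E" by simp
    qed
  qed
  ultimately show ?thesis unfolding analytic_set_def by blast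
qed

text \<open>Being analytic is not preserved under complements, which a condition built from nested
  quantifiers over countable sets and biconditionals needs. Requiring a predicate and its negation to
  be analytic gives a class closed under all of these. By Suslin's theorem it consists, on
  Polish spaces, of the Borel predicates.\<close>

definition bianalytic :: "('a::topological_space \<Rightarrow> bool) \<Rightarrow> bool" where
  "bianalytic P \<longleftrightarrow> analytic_set {a. P a} \<and> analytic_set {a. \<not> P a}"

lemma bianalytic_not: "bianalytic P \<Longrightarrow> bianalytic (\<lambda>a. \<not> P a)"
  by (simp add: bianalytic_def)

lemma bianalytic_const: "bianalytic (\<lambda>a. c)"
  by (cases c) (auto simp: bianalytic_def intro: analytic_closed)

lemma bianalytic_ex_countable:
  assumes "countable I" "\<And>i. i \<in> I \<Longrightarrow> bianalytic (P i)"
  shows "bianalytic (\<lambda>a. \<exists>i\<in>I. P i a)"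
proof (cases "I = {}")
  case True
  then show ?thesis by (simp add: bianalytic_const)
next
  case False
  define i where "i = from_nat_into I"
  have I: "I = range i" using range_from_nat_into[OF False assms(1)] by (simp add: i_def)
  have "analytic_set (\<Union>n. {a. P (i n) a})" "analytic_set (\<Inter>n. {a. \<not> P (i n) a})"
    using assms(2) by (auto simp: I bianalytic_def intro!: analytic_UN analytic_INT)
  moreover have "(\<Union>n. {a. P (i n) a}) = {a. \<exists>i\<in>I. P i a}"
    "(\<Inter>n. {a. \<not> P (i n) a}) = {a. \<not> (\<exists>i\<in>I. P i a)}"
    by (auto simp: I)
  ultimately show ?thesis by (simp add: bianalytic_def)
qed

lemma bianalytic_all_countable:
  assumes "countable I" "\<And>i. i \<in> I \<Longrightarrow> bianalytic (P i)"
  shows "bianalytic (\<lambda>a. \<forall>i\<in>I. P i a)"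
  using bianalytic_not[OF bianalytic_ex_countable[of I "\<lambda>i a. \<not> P i a"]] assms
  by (simp add: bianalytic_not)

lemma bianalytic_ex: "(\<And>i::'i::countable. bianalytic (P i)) \<Longrightarrow> bianalytic (\<lambda>a. \<exists>i. P i a)"
  using bianalytic_ex_countable[of UNIV P] by simp

lemma bianalytic_all: "(\<And>i::'i::countable. bianalytic (P i)) \<Longrightarrow> bianalytic (\<lambda>a. \<forall>i. P i a)"
  using bianalytic_all_countable[of UNIV P] by simp

lemma bianalytic_disj:
  assumes "bianalytic P" "bianalytic Q"
  shows "bianalytic (\<lambda>a. P a \<or> Q a)"
proof -
  have "bianalytic (\<lambda>a. if i then P a else Q a)" for i
    using assms by (cases i) auto
  from bianalytic_ex[of "\<lambda>i a. if i then P a else Q a", OF this] show ?thesis by (simp add: ex_bool_eq)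
qed

lemma bianalytic_conj:
  "bianalytic P \<Longrightarrow> bianalytic Q \<Longrightarrow> bianalytic (\<lambda>a. P a \<and> Q a)"
  using bianalytic_not[OF bianalytic_disj[OF bianalytic_not bianalytic_not], of P Q] by simp

lemma bianalytic_imp:
  "bianalytic P \<Longrightarrow> bianalytic Q \<Longrightarrow> bianalytic (\<lambda>a. P a \<longrightarrow> Q a)"
  unfolding imp_conv_disj by (intro bianalytic_disj bianalytic_not)

lemma bianalytic_iff:
  "bianalytic P \<Longrightarrow> bianalytic Q \<Longrightarrow> bianalytic (\<lambda>a. P a \<longleftrightarrow> Q a)"
  unfolding iff_conv_conj_imp by (intro bianalytic_conj bianalytic_imp)

lemma bianalytic_continuous:
  fixes f :: "'a::topological_space \<Rightarrow> 'b::discrete_topology"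
  assumes "continuous_on UNIV f"
  shows "bianalytic (\<lambda>a. Q (f a))"
proof -
  have "analytic_set {a. f a \<in> T}" for T
    by (intro analytic_closed closed_vimage_UNIV[OF assms]) (simp add: closed_def open_discrete)
  from this[of "{y. Q y}"] this[of "{y. \<not> Q y}"] show ?thesis by (simp add: bianalytic_def)
qed

text \<open>Terms with values in a countable type can be substituted into a predicate once their level
  sets are known to be bianalytic; this is how nested terms are handled below.\<close>

lemma bianalytic_subst:
  fixes g :: "'a::topological_space \<Rightarrow> 'c::countable"
  assumes "\<And>c. bianalytic (\<lambda>a. g a = c)" "\<And>c. bianalytic (\<lambda>a. P a c)"
  shows "bianalytic (\<lambda>a. P a (g a))"
proof -
  have "bianalytic (\<lambda>a. \<exists>c. g a = c \<and> P a c)"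
    by (intro bianalytic_ex bianalytic_conj assms)
  then show ?thesis by simp
qed

lemma bianalytic_map:
  assumes "\<And>t c. t \<in> set ts \<Longrightarrow> bianalytic (\<lambda>a. f a t = c)"
  shows "bianalytic (\<lambda>a. map (f a) ts = cs)"
  using assms
proof (induction ts arbitrary: cs)
  case (Cons t ts)
  then show ?case
    by (cases cs) (auto intro!: bianalytic_conj bianalytic_const)
qed (auto intro: bianalytic_const)

section \<open>Having a generically c.e. copy is an analytic property\<close>

instance recf :: countable by countable_datatype
instance tm :: countable by countable_datatype

lemma sat_cong:
  "(\<And>v. v \<in> fv \<phi> \<Longrightarrow> s v = s' v) \<Longrightarrow> sat A D s \<phi> \<longleftrightarrow> sat A D s' \<phi>"
proof (induction \<phi> arbitrary: s s')
  have tm: "eval_tm A s t = eval_tm A s' t" if "\<And>v. v \<in> fv_tm t \<Longrightarrow> s v = s' v" for s s' t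
    using that
  proof (induction t)
    case (App F ts)
    then have "map (eval_tm A s) ts = map (eval_tm A s') ts" by auto
    then show ?case by (simp only: eval_tm.simps)
  qed auto
  {
    case (Eq t u)
    then show ?case using tm[of t s s'] tm[of u s s'] by auto
  next
    case (Rel R ts)
    then have "map (eval_tm A s) ts = map (eval_tm A s') ts" by (auto intro!: tm)
    then show ?case by (simp only: sat.simps)
  next
    case (Neg \<phi>)
    then show ?case by (metis fv.simps(3) sat.simps(3))
  next
    case (And \<phi> \<psi>)
    have "sat A D s \<phi> \<longleftrightarrow> sat A D s' \<phi>" "sat A D s \<psi> \<longleftrightarrow> sat A D s' \<psi>"
      using And.prems by (auto intro!: And.IH)
    then show ?case by simp
  next
    case (Or \<phi> \<psi>)
    have "sat A D s \<phi> \<longleftrightarrow> sat A D s' \<phi>" "sat A D s \<psi> \<longleftrightarrow> sat A D s' \<psi>"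
      using Or.prems by (auto intro!: Or.IH)
    then show ?case by simp
  next
    case (Ex x \<phi>)
    have "sat A D (s(x := a)) \<phi> \<longleftrightarrow> sat A D (s'(x := a)) \<phi>" for a
      using Ex.prems by (intro Ex.IH) auto
    then show ?case by simp
  next
    case (All x \<phi>)
    have "sat A D (s(x := a)) \<phi> \<longleftrightarrow> sat A D (s'(x := a)) \<phi>" for a
      using All.prems by (intro All.IH) auto
    then show ?case by simp
  next
    case (Disj I f)
    have "sat A D s (f i) \<longleftrightarrow> sat A D s' (f i)" if "i \<in> I" for i
      using Disj.prems that by (intro Disj.IH) auto
    then show ?case by simp
  next
    case (Conj I f)
    have "sat A D s (f i) \<longleftrightarrow> sat A D s' (f i)" if "i \<in> I" for i
      using Conj.prems that by (intro Conj.IH) auto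
    then show ?case by simp
  }
qed

lemma fv_foldr_Ex: "fv (foldr Ex xs \<psi>) = fv \<psi> - set xs"
  by (induction xs) auto

lemma wf_foldr_Ex: "wf_fm L (foldr Ex xs \<psi>) \<longleftrightarrow> wf_fm L \<psi>"
  by (induction xs) auto

lemma finite_fv_quantifier_free: "quantifier_free \<psi> \<Longrightarrow> finite (fv \<psi>)"
proof (induction rule: quantifier_free.induct)
  have tm: "finite (fv_tm t)" for t by (induction t) auto
  {
    case (1 t u)
    show ?case by (simp add: tm)
  next
    case (2 R ts)
    show ?case by (simp add: tm)
  }
qed auto

text \<open>The finitely quantified disjuncts have matrices in \<open>\<Pi>\<^sub>0\<close>, the only level below \<open>1\<close>.\<close>

lemma Sigma_fm_1_iff:
  "Sigma_fm 1 \<phi> \<longleftrightarrow>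
    (\<exists>I f. \<phi> = Disj I f \<and> (\<forall>i\<in>I. \<exists>xs \<psi>. f i = foldr Ex xs \<psi> \<and> quantifier_free \<psi>))"
proof
  have Pi: "Pi_fm 0 \<psi> \<longleftrightarrow> quantifier_free \<psi>" for \<psi>
    by (auto elim: Pi_fm.cases intro: Pi_0)
  show "\<exists>I f. \<phi> = Disj I f \<and> (\<forall>i\<in>I. \<exists>xs \<psi>. f i = foldr Ex xs \<psi> \<and> quantifier_free \<psi>)"
    if "Sigma_fm 1 \<phi>"
    using that by (cases rule: Sigma_fm.cases) (simp_all add: Pi)
  show "Sigma_fm 1 \<phi>"
    if "\<exists>I f. \<phi> = Disj I f \<and> (\<forall>i\<in>I. \<exists>xs \<psi>. f i = foldr Ex xs \<psi> \<and> quantifier_free \<psi>)"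
  proof -
    from that obtain I f where \<phi>: "\<phi> = Disj I f"
      and f: "\<forall>i\<in>I. \<exists>xs \<psi>. f i = foldr Ex xs \<psi> \<and> quantifier_free \<psi>" by blast
    show ?thesis unfolding \<phi>
      by (rule Sigma_pos) (use f Pi in force)+
  qed
qed

definition prenex_existential :: "fm set" where
  "prenex_existential = {foldr Ex xs \<psi> | xs \<psi>. quantifier_free \<psi>}"

text \<open>A countable copy of the finitary quantifier-free formulas: \<^typ>\<open>fm\<close> itself is uncountable.\<close>

datatype qf = QEq tm tm | QRel nat "tm list" | QNeg qf | QAnd qf qf | QOr qf qf

instance qf :: countable by countable_datatype

primrec fm_of_qf :: "qf \<Rightarrow> fm" where
  "fm_of_qf (QEq t u) = Eq t u"
| "fm_of_qf (QRel R ts) = Rel R ts"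
| "fm_of_qf (QNeg \<phi>) = Neg (fm_of_qf \<phi>)"
| "fm_of_qf (QAnd \<phi> \<psi>) = And (fm_of_qf \<phi>) (fm_of_qf \<psi>)"
| "fm_of_qf (QOr \<phi> \<psi>) = Or (fm_of_qf \<phi>) (fm_of_qf \<psi>)"

lemma countable_prenex_existential: "countable prenex_existential"
proof -
  have qf: "\<psi> \<in> range fm_of_qf" if "quantifier_free \<psi>" for \<psi>
    using that
  proof (induction rule: quantifier_free.induct)
    case (1 t u)
    have "Eq t u = fm_of_qf (QEq t u)" by simp
    then show ?case by blast
  next
    case (2 R ts)
    have "Rel R ts = fm_of_qf (QRel R ts)" by simp
    then show ?case by blast
  next
    case (3 \<phi>)
    then obtain p where "\<phi> = fm_of_qf p" by blast
    then have "Neg \<phi> = fm_of_qf (QNeg p)" by simp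
    then show ?case by blast
  next
    case (4 \<phi> \<psi>)
    then obtain p q where "\<phi> = fm_of_qf p" "\<psi> = fm_of_qf q" by blast
    then have "And \<phi> \<psi> = fm_of_qf (QAnd p q)" by simp
    then show ?case by blast
  next
    case (5 \<phi> \<psi>)
    then obtain p q where "\<phi> = fm_of_qf p" "\<psi> = fm_of_qf q" by blast
    then have "Or \<phi> \<psi> = fm_of_qf (QOr p q)" by simp
    then show ?case by blast
  qed
  have "prenex_existential \<subseteq> range (\<lambda>(xs, q). foldr Ex xs (fm_of_qf q))"
    unfolding prenex_existential_def using qf by force
  then show ?thesis by (rule countable_subset) simp
qed

text \<open>Finite lists stand for assignments, so that countably many assignments realize every choice of values
  for finitely many variables.\<close>

definition assignment_of :: "nat list \<Rightarrow> nat \<Rightarrow> nat" where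
  "assignment_of l v = (if v < length l then l ! v else 0)"

lemma ex_assignment_of:
  assumes "finite V"
  shows "\<exists>l. \<forall>v\<in>V. assignment_of l v = s v"
proof -
  obtain n where "V \<subseteq> {..<n}" using assms finite_nat_iff_bounded by blast
  then have "\<forall>v\<in>V. assignment_of (map s [0..<n]) v = s v"
    by (auto simp: assignment_of_def)
  then show ?thesis by blast
qed

text \<open>The definition of \<open>\<Sigma>\<^sub>1\<close> elementarity quantifies over uncountably many formulas and
  assignments. Only the disjuncts and the values on the free variables matter, and there are
  countably many of those.\<close>

lemma Sigma_elementary_1_iff:
  "Sigma_elementary L 1 A D \<longleftrightarrow> substructure_on L A D \<and>
    (\<forall>\<phi>\<in>prenex_existential. \<forall>l. wf_fm L \<phi> \<longrightarrow> (\<forall>v. v \<in> fv \<phi> \<longrightarrow> assignment_of l v \<in> D) \<longrightarrow>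
      (sat A D (assignment_of l) \<phi> \<longleftrightarrow> sat A UNIV (assignment_of l) \<phi>))"
  (is "_ \<longleftrightarrow> _ \<and> ?R")
proof -
  have "?R" if *: "\<forall>\<phi> s. Sigma_fm 1 \<phi> \<and> wf_fm L \<phi> \<and> finite (fv \<phi>) \<and> s ` fv \<phi> \<subseteq> D \<longrightarrow>
        (sat A D s \<phi> \<longleftrightarrow> sat A UNIV s \<phi>)"
  proof (intro ballI allI impI)
    fix \<phi> l assume \<phi>: "\<phi> \<in> prenex_existential" "wf_fm L \<phi>"
      and l: "\<forall>v. v \<in> fv \<phi> \<longrightarrow> assignment_of l v \<in> D"
    have "Sigma_fm 1 (Disj {0} (\<lambda>_. \<phi>))"
      using \<phi>(1) unfolding Sigma_fm_1_iff prenex_existential_def by fastforce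
    moreover have "finite (fv \<phi>)"
      using \<phi>(1) by (auto simp: prenex_existential_def fv_foldr_Ex finite_fv_quantifier_free)
    ultimately show "sat A D (assignment_of l) \<phi> \<longleftrightarrow> sat A UNIV (assignment_of l) \<phi>"
      using *[rule_format, of "Disj {0} (\<lambda>_. \<phi>)" "assignment_of l"] \<phi>(2) l by auto
  qed
  moreover have "sat A D s \<phi> \<longleftrightarrow> sat A UNIV s \<phi>"
    if R: "?R" and \<phi>: "Sigma_fm 1 \<phi>" "wf_fm L \<phi>" "finite (fv \<phi>)" "s ` fv \<phi> \<subseteq> D" for \<phi> s
  proof -
    obtain I f where f: "\<phi> = Disj I f" "\<forall>i\<in>I. f i \<in> prenex_existential"
      using \<phi>(1) unfolding Sigma_fm_1_iff prenex_existential_def by blast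
    obtain l where l: "\<forall>v\<in>fv \<phi>. assignment_of l v = s v"
      using ex_assignment_of[OF \<phi>(3)] by blast
    have "sat A D s (f i) \<longleftrightarrow> sat A UNIV s (f i)" if "i \<in> I" for i
    proof -
      have sub: "fv (f i) \<subseteq> fv \<phi>" using that f by auto
      have "sat A E s (f i) \<longleftrightarrow> sat A E (assignment_of l) (f i)" for E
        using sub l by (intro sat_cong) auto
      moreover have "wf_fm L (f i)" using that \<phi>(2) f by auto
      moreover have "\<forall>v. v \<in> fv (f i) \<longrightarrow> assignment_of l v \<in> D"
        using sub l \<phi>(4) by (auto simp: image_subset_iff subset_iff)
      ultimately show ?thesis using R f that by blast
    qed
    then show ?thesis by (simp add: f)
  qed
  ultimately show ?thesis unfolding Sigma_elementary_def by blast
qed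

context
  fixes B :: "'a::topological_space \<Rightarrow> struct" and D :: "'a \<Rightarrow> nat set"
  assumes atom_rel: "\<And>R xs. bianalytic (\<lambda>a. fst (B a) R xs)"
    and atom_fun: "\<And>F xs y. bianalytic (\<lambda>a. snd (B a) F xs = y)"
    and atom_dom: "\<And>x. bianalytic (\<lambda>a. x \<in> D a)"
begin

lemma bianalytic_structures: "bianalytic (\<lambda>a. B a \<in> structures L)"
  unfolding structures_def mem_Collect_eq
  by (intro bianalytic_conj bianalytic_all bianalytic_imp bianalytic_const bianalytic_not atom_rel atom_fun)

lemma bianalytic_dom_list: "bianalytic (\<lambda>a. set xs \<subseteq> D a)"
  unfolding subset_iff by (intro bianalytic_all bianalytic_imp bianalytic_const atom_dom)

lemma bianalytic_substructure_on: "bianalytic (\<lambda>a. substructure_on L (B a) (D a))"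
proof -
  have "bianalytic (\<lambda>a. snd (B a) F xs \<in> D a)" for F xs
    by (rule bianalytic_subst[OF atom_fun atom_dom])
  then have "bianalytic (\<lambda>a. (\<exists>x. x \<in> D a) \<and> (\<forall>F\<in>funs L. \<forall>xs. length xs = fun_arity L F \<longrightarrow>
      set xs \<subseteq> D a \<longrightarrow> snd (B a) F xs \<in> D a))"
    by (intro bianalytic_conj bianalytic_ex bianalytic_all bianalytic_all_countable bianalytic_imp
        bianalytic_const atom_dom bianalytic_dom_list) auto
  then show ?thesis unfolding substructure_on_def by (simp add: ex_in_conv)
qed

lemma bianalytic_eval_tm: "bianalytic (\<lambda>a. eval_tm (B a) s t = c)"
proof (induction t arbitrary: c)
  case (App F ts)
  have "bianalytic (\<lambda>a. snd (B a) F (map (eval_tm (B a) s) ts) = c)"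
    by (rule bianalytic_subst[OF bianalytic_map atom_fun]) (rule App)
  then show ?case by simp
qed (simp add: bianalytic_const)

lemma bianalytic_sat:
  assumes dom': "\<And>x. bianalytic (\<lambda>a. x \<in> E a)"
  shows "bianalytic (\<lambda>a. sat (B a) (E a) s \<phi>)"
proof (induction \<phi> arbitrary: s)
  case (Eq t u)
  have "bianalytic (\<lambda>a. eval_tm (B a) s t = eval_tm (B a) s u)"
    by (rule bianalytic_subst[OF bianalytic_eval_tm bianalytic_eval_tm])
  then show ?case by simp
next
  case (Rel R ts)
  have "bianalytic (\<lambda>a. fst (B a) R (map (eval_tm (B a) s) ts))"
    by (rule bianalytic_subst[OF bianalytic_map atom_rel]) (rule bianalytic_eval_tm)
  then show ?case by simp
next
  case (Ex x \<phi>)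
  then have "bianalytic (\<lambda>a. \<exists>c. c \<in> E a \<and> sat (B a) (E a) (s(x := c)) \<phi>)"
    by (intro bianalytic_ex bianalytic_conj dom')
  then show ?case by (simp add: Bex_def)
next
  case (All x \<phi>)
  then have "bianalytic (\<lambda>a. \<forall>c. c \<in> E a \<longrightarrow> sat (B a) (E a) (s(x := c)) \<phi>)"
    by (intro bianalytic_all bianalytic_imp dom')
  then show ?case by (simp add: Ball_def)
qed (auto intro: bianalytic_not bianalytic_conj bianalytic_disj bianalytic_ex_countable
    bianalytic_all_countable)

lemma bianalytic_Sigma_elementary_1: "bianalytic (\<lambda>a. Sigma_elementary L 1 (B a) (D a))"
  unfolding Sigma_elementary_1_iff
  by (intro bianalytic_conj bianalytic_substructure_on bianalytic_all_countable
      countable_prenex_existential bianalytic_all bianalytic_imp bianalytic_const bianalytic_iff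
      bianalytic_sat atom_dom)

lemma bianalytic_ce_rel:
  assumes "\<And>xs. bianalytic (\<lambda>a. xs \<in> X a)"
  shows "bianalytic (\<lambda>a. ce_rel n (X a))"
  unfolding ce_rel_def set_eq_iff mem_Collect_eq
  by (intro bianalytic_ex bianalytic_all bianalytic_iff bianalytic_const assms)

lemma bianalytic_ce_substructure: "bianalytic (\<lambda>a. ce_substructure L (B a) (D a))"
proof -
  have "bianalytic (\<lambda>a. \<exists>x. x \<in> D a \<and> ys = [x])" for ys
    by (intro bianalytic_ex bianalytic_conj atom_dom bianalytic_const)
  then have "bianalytic (\<lambda>a. ys \<in> (\<lambda>x. [x]) ` D a)" for ys
    by (simp add: image_iff Bex_def)
  then have 1: "bianalytic (\<lambda>a. ce_set (D a))"
    unfolding ce_set_def by (rule bianalytic_ce_rel)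
  have 2: "bianalytic (\<lambda>a. ce_rel n {xs. length xs = m \<and> set xs \<subseteq> D a \<and> fst (B a) R xs})" for n m R
    by (intro bianalytic_ce_rel)
      (simp add: bianalytic_conj bianalytic_const bianalytic_dom_list atom_rel)
  have graph: "bianalytic (\<lambda>a. ys = xs @ [snd (B a) F xs])" for xs ys F
    by (rule bianalytic_subst[OF atom_fun bianalytic_const])
  have 3: "bianalytic (\<lambda>a. ce_rel n {xs @ [snd (B a) F xs] | xs. length xs = m \<and> set xs \<subseteq> D a})"
    for n m F
    unfolding mem_Collect_eq
    by (intro bianalytic_ce_rel, unfold mem_Collect_eq,
        intro bianalytic_ex bianalytic_conj bianalytic_const bianalytic_dom_list graph)
  show ?thesis
    unfolding ce_substructure_def
    by (intro bianalytic_conj bianalytic_substructure_on 1 bianalytic_all_countable 2 3) auto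
qed

lemma bianalytic_dense_set: "bianalytic (\<lambda>a. dense_set (D a))"
proof -
  have "bianalytic (\<lambda>a. card (D a \<inter> {0..n}) = c)" for n c
  proof -
    have "bianalytic (\<lambda>a. \<exists>l. (\<forall>x. x \<in> set l \<longleftrightarrow> x \<in> D a \<and> x \<le> n) \<and> card (set l) = c)"
      by (intro bianalytic_ex bianalytic_conj bianalytic_all bianalytic_iff bianalytic_const atom_dom)
    moreover have "(\<exists>l. (\<forall>x. x \<in> set l \<longleftrightarrow> x \<in> D a \<and> x \<le> n) \<and> card (set l) = c)
        \<longleftrightarrow> card (D a \<inter> {0..n}) = c" for a
    proof -
      have "(\<forall>x. x \<in> set l \<longleftrightarrow> x \<in> D a \<and> x \<le> n) \<longleftrightarrow> set l = D a \<inter> {0..n}" for l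
        by (simp add: set_eq_iff)
      moreover obtain l where "set l = D a \<inter> {0..n}"
        using finite_list[of "D a \<inter> {0..n}"] by auto
      ultimately show ?thesis by metis
    qed
    ultimately show ?thesis by simp
  qed
  then have "bianalytic (\<lambda>a. \<bar>real (card (D a \<inter> {0..n})) / real (n + 1) - 1\<bar> < e)" for n e
    by (rule bianalytic_subst[OF _ bianalytic_const])
  then have "bianalytic (\<lambda>a. \<forall>k::nat. \<exists>N. \<forall>n. N \<le> n \<longrightarrow>
      \<bar>real (card (D a \<inter> {0..n})) / real (n + 1) - 1\<bar> < 1 / Suc k)"
    by (intro bianalytic_ex bianalytic_all bianalytic_imp bianalytic_const)
  moreover have "(f \<longlonglongrightarrow> 1) \<longleftrightarrow> (\<forall>k::nat. \<exists>N. \<forall>n. N \<le> n \<longrightarrow> \<bar>f n - 1\<bar> < 1 / Suc k)"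
    for f :: "nat \<Rightarrow> real"
    unfolding LIMSEQ_iff real_norm_def
  proof safe
    fix e :: real
    assume *: "\<forall>k::nat. \<exists>N. \<forall>n. N \<le> n \<longrightarrow> \<bar>f n - 1\<bar> < 1 / Suc k" and "e > 0"
    then obtain k where "inverse (real (Suc k)) < e" using reals_Archimedean by blast
    then have "1 / real (Suc k) < e" by (simp add: inverse_eq_divide)
    with * show "\<exists>no. \<forall>n\<ge>no. \<bar>f n - 1\<bar> < e" by (meson less_trans)
  qed simp
  ultimately show ?thesis unfolding dense_set_def by simp
qed

end

lemma bianalytic_isomorphic_via:
  fixes A B :: "'a::topological_space \<Rightarrow> struct" and h :: "'a \<Rightarrow> nat \<Rightarrow> nat"
  assumes A: "\<And>R xs. bianalytic (\<lambda>a. fst (A a) R xs)" "\<And>F xs y. bianalytic (\<lambda>a. snd (A a) F xs = y)"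
    and B: "\<And>R xs. bianalytic (\<lambda>a. fst (B a) R xs)" "\<And>F xs y. bianalytic (\<lambda>a. snd (B a) F xs = y)"
    and h: "\<And>x y. bianalytic (\<lambda>a. h a x = y)"
  shows "bianalytic (\<lambda>a. bij (h a) \<and>
     (\<forall>R\<in>rels L. \<forall>xs. length xs = rel_arity L R \<longrightarrow>
        (fst (A a) R xs \<longleftrightarrow> fst (B a) R (map (h a) xs))) \<and>
     (\<forall>F\<in>funs L. \<forall>xs. length xs = fun_arity L F \<longrightarrow>
        h a (snd (A a) F xs) = snd (B a) F (map (h a) xs)))"
proof -
  have "bianalytic (\<lambda>a. \<forall>y. \<exists>x. h a x = y \<and> (\<forall>x'. h a x' = y \<longrightarrow> x' = x))"
    by (intro bianalytic_all bianalytic_ex bianalytic_conj bianalytic_imp bianalytic_const h)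
  then have 1: "bianalytic (\<lambda>a. bij (h a))"
    unfolding bij_iff Ex1_def by simp
  have 2: "bianalytic (\<lambda>a. fst (B a) R (map (h a) xs))" for R xs
    by (rule bianalytic_subst[OF bianalytic_map[OF h] B(1)])
  have lhs: "bianalytic (\<lambda>a. h a (snd (A a) F xs) = y)" for F xs y
    by (rule bianalytic_subst[OF A(2) h])
  have rhs: "bianalytic (\<lambda>a. snd (B a) F (map (h a) xs) = y)" for F xs y
    by (rule bianalytic_subst[OF bianalytic_map[OF h] B(2)])
  have "bianalytic (\<lambda>a. y = snd (B a) F (map (h a) xs))" for F xs y
    using rhs by (simp add: eq_commute)
  then have 3: "bianalytic (\<lambda>a. h a (snd (A a) F xs) = snd (B a) F (map (h a) xs))" for F xs
    by (rule bianalytic_subst[OF lhs])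
  show ?thesis
    by (intro bianalytic_conj bianalytic_all_countable bianalytic_all bianalytic_imp
        bianalytic_const bianalytic_iff 1 2 3 A) auto
qed

text \<open>Baire space maps continuously onto the space of triples consisting of a structure, a map and a set,
  so a quantifier over such triples is a projection along Baire space.\<close>

definition decode_triple :: "(nat \<Rightarrow> nat) \<Rightarrow> struct \<times> (nat \<Rightarrow> nat) \<times> (nat \<Rightarrow> bool)" where
  "decode_triple z =
    ((\<lambda>R xs. z (to_nat (0::nat, R, xs)) = 1, \<lambda>F xs. z (to_nat (1::nat, F, xs))),
     \<lambda>n. z (to_nat (2::nat, n, [] :: nat list)), \<lambda>n. z (to_nat (3::nat, n, [] :: nat list)) = 1)"

lemma continuous_decode_triple: "continuous_on UNIV decode_triple"
proof -
  have "continuous_on UNIV (\<lambda>z :: nat \<Rightarrow> nat. z n = 1)" for n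
    by (rule continuous_if_prefix_determined[of "Suc n"]) simp
  then show ?thesis
    unfolding decode_triple_def
    by (intro continuous_on_Pair continuous_on_coordinatewise_then_product
        continuous_on_coordinate)
qed

lemma surj_decode_triple: "surj decode_triple"
proof (rule surjI)
  fix t :: "struct \<times> (nat \<Rightarrow> nat) \<times> (nat \<Rightarrow> bool)"
  show "decode_triple (\<lambda>k. case from_nat k :: nat \<times> nat \<times> nat list of (i, n, xs) \<Rightarrow>
      if i = 0 then of_bool (fst (fst t) n xs) else if i = 1 then snd (fst t) n xs
      else if i = 2 then fst (snd t) n else of_bool (snd (snd t) n)) = t"
    by (simp add: decode_triple_def prod_eq_iff fun_eq_iff)
qed

proposition analytic_generically_ce_copy:
  "analytic_set {A \<in> structures L. \<exists>B. is_copy L A B \<and> Sigma_generically_ce L 1 B}"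
proof -
  define \<Phi> where "\<Phi> A t \<longleftrightarrow> A \<in> structures L \<and> fst t \<in> structures L \<and>
    (bij (fst (snd t)) \<and>
     (\<forall>R\<in>rels L. \<forall>xs. length xs = rel_arity L R \<longrightarrow>
        (fst A R xs \<longleftrightarrow> fst (fst t) R (map (fst (snd t)) xs))) \<and>
     (\<forall>F\<in>funs L. \<forall>xs. length xs = fun_arity L F \<longrightarrow>
        fst (snd t) (snd A F xs) = snd (fst t) F (map (fst (snd t)) xs))) \<and>
    dense_set {x. snd (snd t) x} \<and> ce_substructure L (fst t) {x. snd (snd t) x} \<and>
    Sigma_elementary L 1 (fst t) {x. snd (snd t) x}"
    for A :: struct and t :: "struct \<times> (nat \<Rightarrow> nat) \<times> (nat \<Rightarrow> bool)"
  note cont = continuous_on_id continuous_on_fst continuous_on_snd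
    continuous_on_product_then_coordinatewise
  have A1: "bianalytic (\<lambda>p :: struct \<times> struct \<times> (nat \<Rightarrow> nat) \<times> (nat \<Rightarrow> bool). fst (fst p) R xs)" for R xs
    by (rule bianalytic_continuous[where f = "\<lambda>p. fst (fst p) R xs" and Q = "\<lambda>c. c"]) (rule cont)+
  have A2: "bianalytic (\<lambda>p :: struct \<times> struct \<times> (nat \<Rightarrow> nat) \<times> (nat \<Rightarrow> bool). snd (fst p) F xs = y)" for F xs y
    by (rule bianalytic_continuous[where f = "\<lambda>p. snd (fst p) F xs" and Q = "\<lambda>c. c = y"]) (rule cont)+
  have B1: "bianalytic (\<lambda>p :: struct \<times> struct \<times> (nat \<Rightarrow> nat) \<times> (nat \<Rightarrow> bool). fst (fst (snd p)) R xs)" for R xs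
    by (rule bianalytic_continuous[where f = "\<lambda>p. fst (fst (snd p)) R xs" and Q = "\<lambda>c. c"]) (rule cont)+
  have B2: "bianalytic (\<lambda>p :: struct \<times> struct \<times> (nat \<Rightarrow> nat) \<times> (nat \<Rightarrow> bool). snd (fst (snd p)) F xs = y)" for F xs y
    by (rule bianalytic_continuous[where f = "\<lambda>p. snd (fst (snd p)) F xs" and Q = "\<lambda>c. c = y"]) (rule cont)+
  have h: "bianalytic (\<lambda>p :: struct \<times> struct \<times> (nat \<Rightarrow> nat) \<times> (nat \<Rightarrow> bool). fst (snd (snd p)) x = y)" for x y
    by (rule bianalytic_continuous[where f = "\<lambda>p. fst (snd (snd p)) x" and Q = "\<lambda>c. c = y"]) (rule cont)+
  have D': "bianalytic (\<lambda>p :: struct \<times> struct \<times> (nat \<Rightarrow> nat) \<times> (nat \<Rightarrow> bool). snd (snd (snd p)) x)" for x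
    by (rule bianalytic_continuous[where f = "\<lambda>p. snd (snd (snd p)) x" and Q = "\<lambda>c. c"]) (rule cont)+
  have D: "bianalytic (\<lambda>p :: struct \<times> struct \<times> (nat \<Rightarrow> nat) \<times> (nat \<Rightarrow> bool). x \<in> {x. snd (snd (snd p)) x})" for x
    unfolding mem_Collect_eq by (rule D')
  have "bianalytic (\<lambda>p. \<Phi> (fst p) (snd p))"
    unfolding \<Phi>_def
    by (intro bianalytic_conj[OF bianalytic_structures[OF A1 A2 D]]
        bianalytic_conj[OF bianalytic_structures[OF B1 B2 D]]
        bianalytic_conj[OF bianalytic_isomorphic_via[OF A1 A2 B1 B2 h]]
        bianalytic_conj[OF bianalytic_dense_set[OF B1 B2 D]]
        bianalytic_conj[OF bianalytic_ce_substructure[OF B1 B2 D]]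
        bianalytic_Sigma_elementary_1[OF B1 B2 D])
  then have "analytic_set {A. \<exists>t. \<Phi> A t}"
    by (intro analytic_projection[OF _ continuous_decode_triple surj_decode_triple])
      (simp add: bianalytic_def)
  moreover have "(\<exists>t. \<Phi> A t) \<longleftrightarrow>
      A \<in> structures L \<and> (\<exists>B. is_copy L A B \<and> Sigma_generically_ce L 1 B)" for A
  proof
    assume "\<exists>t. \<Phi> A t"
    then show "A \<in> structures L \<and> (\<exists>B. is_copy L A B \<and> Sigma_generically_ce L 1 B)"
      unfolding \<Phi>_def is_copy_def isomorphic_def Sigma_generically_ce_def by blast
  next
    assume "A \<in> structures L \<and> (\<exists>B. is_copy L A B \<and> Sigma_generically_ce L 1 B)"
    then obtain B where A: "A \<in> structures L" and "is_copy L A B" "Sigma_generically_ce L 1 B"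
      by blast
    then obtain h D where "B \<in> structures L" "bij h"
      "\<forall>R\<in>rels L. \<forall>xs. length xs = rel_arity L R \<longrightarrow> (fst A R xs \<longleftrightarrow> fst B R (map h xs))"
      "\<forall>F\<in>funs L. \<forall>xs. length xs = fun_arity L F \<longrightarrow> h (snd A F xs) = snd B F (map h xs)"
      "dense_set D" "ce_substructure L B D" "Sigma_elementary L 1 B D"
      unfolding is_copy_def isomorphic_def Sigma_generically_ce_def by blast
    with A have "\<Phi> A (B, h, \<lambda>x. x \<in> D)"
      unfolding \<Phi>_def fst_conv snd_conv Collect_mem_eq by blast
    then show "\<exists>t. \<Phi> A t" by blast
  qed
  ultimately show ?thesis by simp
qed

section \<open>Recursive functions and c.e. relations\<close>

inductive_cases computes_ZeroE: "computes Zero xs y"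
inductive_cases computes_SuccE: "computes Succ xs y"
inductive_cases computes_ProjE: "computes (Proj i) xs y"
inductive_cases computes_CompE: "computes (Comp f gs) xs y"
inductive_cases computes_PrimRec_0E: "computes (PrimRec f g) (0 # xs) y"
inductive_cases computes_PrimRec_SucE: "computes (PrimRec f g) (Suc n # xs) y"
inductive_cases computes_MuE: "computes (Mu f) xs y"

text \<open>Needed to describe the domain of an unbounded search: when it stops, the value \<open>0\<close> found by the inner
  program is the only value of that program there.\<close>

lemma computes_deterministic: "computes f xs y \<Longrightarrow> computes f xs y' \<Longrightarrow> y' = y"
proof (induction arbitrary: y' rule: computes.induct)
  case (1 xs)
  then show ?case by (auto elim: computes_ZeroE)
next
  case (2 x)
  then show ?case by (auto elim: computes_SuccE)
next
  case (3 i xs)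
  then show ?case by (auto elim: computes_ProjE)
next
  case (4 xs gs ys f z)
  from "4.prems" obtain ys' where ys': "list_all2 (\<lambda>g y. computes g xs y) gs ys'" "computes f ys' y'"
    using computes_CompE by blast
  have "ys' = ys"
  proof (rule nth_equalityI)
    show len: "length ys' = length ys"
      using list_all2_lengthD[OF "4.IH"(1)] list_all2_lengthD[OF ys'(1)] by simp
    fix i assume i: "i < length ys'"
    have "computes (gs ! i) xs (ys' ! i)"
      by (rule list_all2_nthD2[OF ys'(1) i])
    moreover have "\<forall>y'. computes (gs ! i) xs y' \<longrightarrow> y' = ys ! i"
      by (rule conjunct2[OF list_all2_nthD2[OF "4.IH"(1) i[unfolded len]]])
    ultimately show "ys' ! i = ys ! i" by blast
  qed
  then show ?case using "4.IH"(2) ys'(2) by blast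
next
  case (5 f xs y g)
  then show ?case using computes_PrimRec_0E by blast
next
  case (6 f g n xs y z)
  from "6.prems" obtain y1 where "computes (PrimRec f g) (n # xs) y1" "computes g (n # y1 # xs) y'"
    using computes_PrimRec_SucE by blast
  then show ?case using "6.IH" by blast
next
  case (7 f n xs)
  from "7.prems" have y': "computes f (y' # xs) 0" "\<forall>m<y'. \<exists>y>0. computes f (m # xs) y"
    using computes_MuE by blast+
  have "\<not> n < y'"
  proof
    assume "n < y'"
    then obtain y where "y > 0" "computes f (n # xs) y" using y'(2) by blast
    with "7.IH"(1) show False by blast
  qed
  moreover have "\<not> y' < n"
  proof
    assume "y' < n"
    then obtain y where "y > 0" "\<And>y2. computes f (y' # xs) y2 \<Longrightarrow> y2 = y"
      using "7.IH"(2) by blast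
    with y'(1) show False by blast
  qed
  ultimately show ?case by simp
qed

definition recursive :: "nat \<Rightarrow> (nat list \<Rightarrow> nat) \<Rightarrow> bool" where
  "recursive k f \<longleftrightarrow> (\<exists>c. \<forall>xs. length xs = k \<longrightarrow> computes c xs (f xs))"

lemma recursive_proj: "i < k \<Longrightarrow> recursive k (\<lambda>xs. xs ! i)"
  unfolding recursive_def by (auto intro!: exI[of _ "Proj i"] computes.intros)

lemma recursive_comp:
  assumes "recursive (length fs) g" "\<And>f. f \<in> set fs \<Longrightarrow> recursive k f"
  shows "recursive k (\<lambda>xs. g (map (\<lambda>f. f xs) fs))"
proof -
  obtain c where c: "\<And>xs. length xs = length fs \<Longrightarrow> computes c xs (g xs)"
    using assms(1) unfolding recursive_def by blast
  obtain d where d: "\<And>f xs. f \<in> set fs \<Longrightarrow> length xs = k \<Longrightarrow> computes (d f) xs (f xs)"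
    using assms(2) unfolding recursive_def by metis
  have "computes (Comp c (map d fs)) xs (g (map (\<lambda>f. f xs) fs))" if "length xs = k" for xs
    by (rule computes.intros(4)[where ys = "map (\<lambda>f. f xs) fs"])
      (auto simp: list_all2_conv_all_nth intro!: d c that)
  then show ?thesis unfolding recursive_def by blast
qed

lemma recursive_comp1:
  assumes "recursive 1 (\<lambda>xs. g (xs ! 0))" "recursive k f"
  shows "recursive k (\<lambda>xs. g (f xs))"
  using recursive_comp[of "[f]" "\<lambda>xs. g (xs ! 0)" k] assms by simp

lemma recursive_comp2:
  assumes "recursive 2 (\<lambda>xs. g (xs ! 0) (xs ! 1))" "recursive k f1" "recursive k f2"
  shows "recursive k (\<lambda>xs. g (f1 xs) (f2 xs))"
  using recursive_comp[of "[f1, f2]" "\<lambda>xs. g (xs ! 0) (xs ! 1)" k] assms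
  by (auto simp: numeral_2_eq_2)

lemma recursive_Suc: "recursive k f \<Longrightarrow> recursive k (\<lambda>xs. Suc (f xs))"
proof (rule recursive_comp1[where g = Suc])
  show "recursive 1 (\<lambda>xs. Suc (xs ! 0))"
    unfolding recursive_def
    by (rule exI[of _ Succ]) (auto simp: length_Suc_conv intro: computes.intros)
qed

lemma recursive_const: "recursive k (\<lambda>xs. n)"
proof (induction n)
  case 0
  show ?case unfolding recursive_def by (auto intro!: exI[of _ Zero] computes.intros)
qed (rule recursive_Suc)

lemma recursive_PrimRec:
  assumes "recursive k f" "recursive (k + 2) g"
    and "\<And>xs. length xs = k \<Longrightarrow> h (0 # xs) = f xs"
    and "\<And>n xs. length xs = k \<Longrightarrow> h (Suc n # xs) = g (n # h (n # xs) # xs)"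
  shows "recursive (Suc k) h"
proof -
  obtain c where c: "\<And>xs. length xs = k \<Longrightarrow> computes c xs (f xs)"
    using assms(1) unfolding recursive_def by blast
  obtain d where d: "\<And>xs. length xs = k + 2 \<Longrightarrow> computes d xs (g xs)"
    using assms(2) unfolding recursive_def by blast
  have "computes (PrimRec c d) (n # xs) (h (n # xs))" if xs: "length xs = k" for n xs
  proof (induction n)
    case 0
    show ?case using assms(3) xs by (auto intro!: computes.intros c)
  next
    case (Suc n)
    have "computes d (n # h (n # xs) # xs) (h (Suc n # xs))"
      using d[of "n # h (n # xs) # xs"] assms(4) xs by simp
    with Suc show ?case by (rule computes.intros(6))
  qed
  then show ?thesis unfolding recursive_def by (metis length_Suc_conv)
qed

lemma recursive_add:
  assumes "recursive k f1" "recursive k f2"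
  shows "recursive k (\<lambda>xs. f1 xs + f2 xs)"
proof (rule recursive_comp2[where g = "(+)", OF _ assms])
  have "recursive (Suc 1) (\<lambda>xs. xs ! 0 + xs ! 1)"
    by (rule recursive_PrimRec[where f = "\<lambda>xs. xs ! 0" and g = "\<lambda>xs. Suc (xs ! 1)"])
      (auto intro!: recursive_proj recursive_Suc)
  then show "recursive 2 (\<lambda>xs. xs ! 0 + xs ! 1)" by (simp add: numeral_2_eq_2)
qed

lemma recursive_pred: "recursive k f \<Longrightarrow> recursive k (\<lambda>xs. f xs - Suc 0)"
proof (rule recursive_comp1[where g = "\<lambda>n. n - Suc 0"])
  have "recursive (Suc 0) (\<lambda>xs. xs ! 0 - Suc 0)"
    by (rule recursive_PrimRec[where f = "\<lambda>xs. 0" and g = "\<lambda>xs. xs ! 0"])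
      (auto intro!: recursive_proj recursive_const)
  then show "recursive 1 (\<lambda>xs. xs ! 0 - Suc 0)" by simp
qed

lemma recursive_diff:
  assumes "recursive k f1" "recursive k f2"
  shows "recursive k (\<lambda>xs. f1 xs - f2 xs)"
proof (rule recursive_comp2[OF _ assms(2,1), of "\<lambda>n m. m - n"])
  have "recursive (Suc 1) (\<lambda>xs. xs ! 1 - xs ! 0)"
    by (rule recursive_PrimRec[where f = "\<lambda>xs. xs ! 0" and g = "\<lambda>xs. xs ! 1 - Suc 0"])
      (auto intro!: recursive_proj recursive_pred)
  then show "recursive 2 (\<lambda>xs. xs ! 1 - xs ! 0)" by (simp add: numeral_2_eq_2)
qed

lemma recursive_mod_2: "recursive k f \<Longrightarrow> recursive k (\<lambda>xs. f xs mod 2)"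
proof (rule recursive_comp1[where g = "\<lambda>n. n mod 2"])
  have "recursive (Suc 0) (\<lambda>xs. xs ! 0 mod 2)"
    by (rule recursive_PrimRec[where f = "\<lambda>xs. 0" and g = "\<lambda>xs. 1 - xs ! 1"])
      (auto intro!: recursive_proj recursive_const recursive_diff simp: mod_Suc)
  then show "recursive 1 (\<lambda>xs. xs ! 0 mod 2)" by simp
qed

lemma recursive_triangle: "recursive k f \<Longrightarrow> recursive k (\<lambda>xs. triangle (f xs))"
proof (rule recursive_comp1[where g = triangle])
  have "recursive (Suc 0) (\<lambda>xs. triangle (xs ! 0))"
    by (rule recursive_PrimRec[where f = "\<lambda>xs. 0" and g = "\<lambda>xs. xs ! 1 + Suc (xs ! 0)"])
      (auto intro!: recursive_proj recursive_const recursive_add recursive_Suc)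
  then show "recursive 1 (\<lambda>xs. triangle (xs ! 0))" by simp
qed

lemma recursive_prod_encode:
  assumes "recursive k f1" "recursive k f2"
  shows "recursive k (\<lambda>xs. prod_encode (f1 xs, f2 xs))"
  unfolding prod_encode_def split using assms by (intro recursive_add recursive_triangle)

lemma computes_Mu:
  assumes "\<And>n. computes c (n # xs) (t n)" "t n = 0" "\<And>m. m < n \<Longrightarrow> t m > 0"
  shows "computes (Mu c) xs n"
  using assms by (intro computes.intros(7)) (metis, blast)

lemma recursive_Least:
  assumes "recursive (Suc k) t" "\<And>xs. length xs = k \<Longrightarrow> \<exists>n. t (n # xs) = 0"
  shows "recursive k (\<lambda>xs. LEAST n. t (n # xs) = 0)"
proof -
  obtain c where c: "\<And>xs. length xs = Suc k \<Longrightarrow> computes c xs (t xs)"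
    using assms(1) unfolding recursive_def by blast
  have "computes (Mu c) xs (LEAST n. t (n # xs) = 0)" if "length xs = k" for xs
    using that assms(2)[OF that]
    by (intro computes_Mu[where t = "\<lambda>n. t (n # xs)"]) (auto intro: c LeastI_ex dest: not_less_Least)
  then show ?thesis unfolding recursive_def by blast
qed

text \<open>The domain of an unbounded search for a zero of a total function. All c.e. relations below are
  presented in this form, as projections of decidable relations.\<close>

lemma ce_rel_projection:
  assumes "recursive (Suc k) t"
  shows "ce_rel k {xs. length xs = k \<and> (\<exists>n. t (n # xs) = 0)}"
proof -
  obtain c where c: "\<And>xs. length xs = Suc k \<Longrightarrow> computes c xs (t xs)"
    using assms unfolding recursive_def by blast
  have "(\<exists>n. t (n # xs) = 0) \<longleftrightarrow> (\<exists>n. computes (Mu c) xs n)" if xs: "length xs = k" for xs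
  proof
    assume "\<exists>n. t (n # xs) = 0"
    then have "computes (Mu c) xs (LEAST n. t (n # xs) = 0)"
      using xs by (intro computes_Mu[where t = "\<lambda>n. t (n # xs)"])
        (auto intro: c LeastI_ex dest: not_less_Least)
    then show "\<exists>n. computes (Mu c) xs n" by blast
  next
    assume "\<exists>n. computes (Mu c) xs n"
    then obtain n where "computes c (n # xs) 0" by (auto elim: computes_MuE)
    moreover have "computes c (n # xs) (t (n # xs))" using xs by (intro c) simp
    ultimately show "\<exists>n. t (n # xs) = 0" using computes_deterministic by metis
  qed
  then show ?thesis unfolding ce_rel_def by blast
qed

text \<open>The pairing function lists the pairs diagonal by diagonal, and the diagonal of \<open>y\<close> can be found
  by an unbounded search.\<close>

lemma sum_prod_decode:
  "fst (prod_decode y) + snd (prod_decode y) = (LEAST k. Suc y - triangle (Suc k) = 0)"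
proof -
  obtain a b where y: "prod_decode y = (a, b)" by force
  then have "y = prod_encode (a, b)" by (metis prod_decode_inverse)
  then have enc: "y = triangle (a + b) + a" by (simp only: prod_encode_def split)
  have mono: "triangle m \<le> triangle n" if "m \<le> n" for m n
    using that by (induction rule: dec_induct) auto
  have "(LEAST k. Suc y - triangle (Suc k) = 0) = a + b"
  proof (rule Least_equality)
    show "Suc y - triangle (Suc (a + b)) = 0" by (simp add: enc)
    show "a + b \<le> k" if "Suc y - triangle (Suc k) = 0" for k
    proof (rule ccontr)
      assume "\<not> a + b \<le> k"
      then have "triangle (Suc k) \<le> triangle (a + b)" by (intro mono) simp
      with that show False by (simp add: enc)
    qed
  qed
  then show ?thesis by (simp add: y)
qed

lemma fst_prod_decode:
  "fst (prod_decode y) = y - triangle (fst (prod_decode y) + snd (prod_decode y))"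
proof -
  have "y = prod_encode (fst (prod_decode y), snd (prod_decode y))" by simp
  then show ?thesis unfolding prod_encode_def split by linarith
qed

lemma recursive_sum_prod_decode:
  "recursive k f \<Longrightarrow> recursive k (\<lambda>xs. fst (prod_decode (f xs)) + snd (prod_decode (f xs)))"
proof (rule recursive_comp1[where g = "\<lambda>n. fst (prod_decode n) + snd (prod_decode n)"])
  have "\<exists>n. Suc y - triangle (Suc n) = 0" for y by (rule exI[of _ y]) simp
  then have "recursive 1 (\<lambda>xs. LEAST n. Suc ((n # xs) ! 1) - triangle (Suc ((n # xs) ! 0)) = 0)"
    by (intro recursive_Least recursive_diff recursive_Suc recursive_triangle recursive_proj) auto
  then show "recursive 1 (\<lambda>xs. fst (prod_decode (xs ! 0)) + snd (prod_decode (xs ! 0)))"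
    by (simp add: sum_prod_decode)
qed

lemma recursive_fst_prod_decode:
  assumes "recursive k f"
  shows "recursive k (\<lambda>xs. fst (prod_decode (f xs)))"
proof -
  have "recursive k (\<lambda>xs. f xs - triangle (fst (prod_decode (f xs)) + snd (prod_decode (f xs))))"
    by (intro recursive_diff recursive_triangle recursive_sum_prod_decode assms)
  then show ?thesis by (simp only: fst_prod_decode[symmetric])
qed

lemma recursive_snd_prod_decode:
  assumes "recursive k f"
  shows "recursive k (\<lambda>xs. snd (prod_decode (f xs)))"
proof -
  have "recursive k (\<lambda>xs. fst (prod_decode (f xs)) + snd (prod_decode (f xs))
      - fst (prod_decode (f xs)))"
    by (intro recursive_diff recursive_fst_prod_decode recursive_sum_prod_decode assms)
  then show ?thesis by simp
qed


section \<open>A criterion for \<open>\<Sigma>\<^sub>1\<close> elementarity in relational languages\<close>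

lemma sat_foldr_Ex:
  "sat A D s (foldr Ex xs \<psi>) \<longleftrightarrow>
    (\<exists>s'. (\<forall>v. v \<notin> set xs \<longrightarrow> s' v = s v) \<and> (\<forall>v\<in>set xs. s' v \<in> D) \<and> sat A D s' \<psi>)"
proof (induction xs arbitrary: s)
  case Nil
  have "(\<forall>v. s' v = s v) \<longleftrightarrow> s' = s" for s' by auto
  then show ?case by simp
next
  case (Cons x xs)
  show ?case
  proof
    assume "sat A D s (foldr Ex (x # xs) \<psi>)"
    then obtain a s' where "a \<in> D" "\<forall>v. v \<notin> set xs \<longrightarrow> s' v = (s(x := a)) v"
      "\<forall>v\<in>set xs. s' v \<in> D" "sat A D s' \<psi>"
      by (auto simp: Cons.IH)
    moreover from this have "s' x \<in> D" by (cases "x \<in> set xs") auto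
    ultimately show "\<exists>s'. (\<forall>v. v \<notin> set (x # xs) \<longrightarrow> s' v = s v) \<and>
        (\<forall>v\<in>set (x # xs). s' v \<in> D) \<and> sat A D s' \<psi>"
      by (intro exI[of _ s']) auto
  next
    assume "\<exists>s'. (\<forall>v. v \<notin> set (x # xs) \<longrightarrow> s' v = s v) \<and> (\<forall>v\<in>set (x # xs). s' v \<in> D) \<and>
        sat A D s' \<psi>"
    then obtain s' where s': "\<forall>v. v \<notin> set (x # xs) \<longrightarrow> s' v = s v"
      "\<forall>v\<in>set (x # xs). s' v \<in> D" "sat A D s' \<psi>" by blast
    then have "sat A D (s(x := s' x)) (foldr Ex xs \<psi>)"
      unfolding Cons.IH by (intro exI[of _ s']) auto
    with s' show "sat A D s (foldr Ex (x # xs) \<psi>)" by auto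
  qed
qed

lemma sat_quantifier_free_domain: "quantifier_free \<psi> \<Longrightarrow> sat A D s \<psi> \<longleftrightarrow> sat A E s \<psi>"
  by (induction rule: quantifier_free.induct) auto

text \<open>Without function symbols the terms are variables, so a map that is injective and preserves the
  relations on the values of the assignment preserves everything that the formula can say.\<close>

lemma sat_quantifier_free_map:
  assumes "quantifier_free \<psi>" "wf_fm L \<psi>" "funs L = {}" "fv \<psi> \<subseteq> V"
    and "inj_on r (s ` V)"
    and "\<And>R xs. R \<in> rels L \<Longrightarrow> length xs = rel_arity L R \<Longrightarrow> set xs \<subseteq> s ` V \<Longrightarrow>
      fst A R (map r xs) \<longleftrightarrow> fst A R xs"
  shows "sat A D (r \<circ> s) \<psi> \<longleftrightarrow> sat A D s \<psi>"
  using assms(1,2,4)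
proof (induction rule: quantifier_free.induct)
  have tm: "eval_tm A (r \<circ> s) t = r (eval_tm A s t)" "eval_tm A s t \<in> s ` V"
    if "wf_tm L t" "fv_tm t \<subseteq> V" for t
    using that assms(3) by (cases t; simp)+
  {
    case (1 t u)
    then have "wf_tm L t" "wf_tm L u" "fv_tm t \<subseteq> V" "fv_tm u \<subseteq> V" by auto
    then show ?case by (simp only: sat.simps tm inj_on_eq_iff[OF assms(5)])
  next
    case (2 R ts)
    then have "map (eval_tm A (r \<circ> s)) ts = map r (map (eval_tm A s) ts)"
      using tm by (auto simp: UN_subset_iff)
    moreover have "set (map (eval_tm A s) ts) \<subseteq> s ` V"
      using 2 tm by (auto simp: UN_subset_iff)
    ultimately have "fst A R (map (eval_tm A (r \<circ> s)) ts) \<longleftrightarrow> fst A R (map (eval_tm A s) ts)"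
      using 2 assms(6)[of R "map (eval_tm A s) ts"] by (simp only: wf_fm.simps length_map)
    then show ?case by (simp only: sat.simps)
  }
qed auto

text \<open>An existential formula with parameters in \<open>D\<close> sees only a finite set of elements, so it
  suffices to move finite sets into \<open>D\<close> without moving the elements already there.\<close>

lemma Sigma_elementary_1_if_finite_embeddings:
  assumes "funs L = {}" "D \<noteq> {}"
    and emb: "\<And>X. finite X \<Longrightarrow> \<exists>r. inj_on r X \<and> r ` X \<subseteq> D \<and> (\<forall>x\<in>X \<inter> D. r x = x) \<and>
      (\<forall>R\<in>rels L. \<forall>xs. length xs = rel_arity L R \<longrightarrow> set xs \<subseteq> X \<longrightarrow>
        (fst A R (map r xs) \<longleftrightarrow> fst A R xs))"
  shows "Sigma_elementary L 1 A D"
proof -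
  have "sat A D s (foldr Ex xs \<psi>) \<longleftrightarrow> sat A UNIV s (foldr Ex xs \<psi>)"
    if qf: "quantifier_free \<psi>" and wf: "wf_fm L \<psi>" and s: "\<And>v. v \<in> fv \<psi> - set xs \<Longrightarrow> s v \<in> D"
    for s xs \<psi>
  proof
    show "sat A UNIV s (foldr Ex xs \<psi>)" if "sat A D s (foldr Ex xs \<psi>)"
      using that qf sat_quantifier_free_domain unfolding sat_foldr_Ex by blast
  next
    assume "sat A UNIV s (foldr Ex xs \<psi>)"
    then obtain s' where s': "\<And>v. v \<notin> set xs \<Longrightarrow> s' v = s v" "sat A UNIV s' \<psi>"
      unfolding sat_foldr_Ex by blast
    obtain r where r: "inj_on r (s' ` fv \<psi>)" "r ` s' ` fv \<psi> \<subseteq> D" "\<forall>x\<in>s' ` fv \<psi> \<inter> D. r x = x"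
      "\<forall>R\<in>rels L. \<forall>xs. length xs = rel_arity L R \<longrightarrow> set xs \<subseteq> s' ` fv \<psi> \<longrightarrow>
        (fst A R (map r xs) \<longleftrightarrow> fst A R xs)"
      using emb[of "s' ` fv \<psi>"] finite_fv_quantifier_free[OF qf] by blast
    obtain d where d: "d \<in> D" using assms(2) by blast
    \<comment> \<open>Variables that do not occur in the matrix only have to take some value in \<open>D\<close>.\<close>
    define s'' where "s'' v = (if v \<in> fv \<psi> then r (s' v) else if v \<in> set xs then d else s v)" for v
    have "sat A D (r \<circ> s') \<psi>"
      using sat_quantifier_free_map[OF qf wf assms(1) subset_refl r(1)] r(4) s'(2)
        sat_quantifier_free_domain[OF qf] by blast
    moreover have "sat A D s'' \<psi> \<longleftrightarrow> sat A D (r \<circ> s') \<psi>"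
      by (rule sat_cong) (simp add: s''_def)
    moreover have "s'' v = s v" if "v \<notin> set xs" for v
    proof (cases "v \<in> fv \<psi>")
      case True
      have "s' v \<in> s' ` fv \<psi>" using True by (rule imageI)
      moreover have "s' v \<in> D" using True that s s'(1) by simp
      ultimately have "r (s' v) = s' v" using r(3) by blast
      with True that s'(1) show ?thesis by (simp add: s''_def)
    qed (use that in \<open>simp add: s''_def\<close>)
    moreover have "s'' v \<in> D" if "v \<in> set xs" for v
      using that d r(2) by (auto simp: s''_def)
    ultimately show "sat A D s (foldr Ex xs \<psi>)"
      unfolding sat_foldr_Ex by blast
  qed
  then show ?thesis
    unfolding Sigma_elementary_1_iff prenex_existential_def
    using assms(1,2) by (auto simp: substructure_on_def wf_foldr_Ex fv_foldr_Ex)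
qed

section \<open>The tree structures\<close>

text \<open>The node \<open>0\<close> is the root, and \<open>prod_encode\<close> enumerates the pairs of a node and an index as the other
  nodes. This works because a pair is at least its first component, so parents come before
  their children and the tree is well-founded towards the root.\<close>

definition parent :: "nat \<Rightarrow> nat" where "parent y = fst (prod_decode (y - 1))"
definition index :: "nat \<Rightarrow> nat" where "index y = snd (prod_decode (y - 1))"
definition child :: "nat \<Rightarrow> nat \<Rightarrow> nat" where "child a i = Suc (prod_encode (a, i))"

lemma parent_child [simp]: "parent (child a i) = a" and index_child [simp]: "index (child a i) = i"
  and child_pos [simp]: "child a i > 0"
  by (simp_all add: parent_def index_def child_def)

lemma child_parent_index: "y > 0 \<Longrightarrow> child (parent y) (index y) = y"
  by (simp add: parent_def index_def child_def)

lemma child_eq_iff [simp]: "child a i = child b j \<longleftrightarrow> a = b \<and> i = j"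
  by (simp add: child_def)

lemma parent_less: "y > 0 \<Longrightarrow> parent y < y"
  using le_prod_encode_1[of "parent y" "index y"] child_parent_index[of y]
  by (simp add: child_def)

lemma index_less: "y > 0 \<Longrightarrow> index y < y"
  using le_prod_encode_2[of "index y" "parent y"] child_parent_index[of y]
  by (simp add: child_def)

definition tree_lang :: language where
  "tree_lang = \<lparr>rels = {0, 1}, funs = {}, rel_arity = (\<lambda>_. 2), fun_arity = (\<lambda>_. 0)\<rparr>"

text \<open>Relation \<open>0\<close> or \<open>1\<close>, according to the label of the child, between each child and its parent.\<close>

definition tree_struct :: "(nat \<Rightarrow> bool) \<Rightarrow> struct" where
  "tree_struct l = (\<lambda>R xs. R \<in> {0, 1} \<and>
     (\<exists>y z. xs = [y, z] \<and> y > 0 \<and> parent y = z \<and> (R = 1 \<longleftrightarrow> l y)), \<lambda>F xs. 0)"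

lemma tree_struct_pair:
  "fst (tree_struct l) R [y, z] \<longleftrightarrow> R \<in> {0, 1} \<and> y > 0 \<and> parent y = z \<and> (R = 1 \<longleftrightarrow> l y)"
  by (auto simp: tree_struct_def)

lemma tree_struct_in_structures: "tree_struct l \<in> structures tree_lang"
  by (auto simp: structures_def tree_struct_def tree_lang_def)

text \<open>A map from the tree with labels \<open>l\<close> to the full labelled tree which inverts \<open>\<iota>\<close> on its range. A node
  outside the range goes to a child of the image of its parent. The parity of the index of
  that child gives it the right label, the summand \<open>y\<close> keeps different nodes apart, and the summand \<open>N\<close>
  avoids the preimages of the nodes up to \<open>N\<close> in the range of \<open>\<iota>\<close>.\<close>

function extend_inverse :: "(nat \<Rightarrow> nat) \<Rightarrow> (nat \<Rightarrow> bool) \<Rightarrow> nat \<Rightarrow> nat \<Rightarrow> nat" where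
  "extend_inverse \<iota> l N y =
    (if y = 0 then 0 else if y \<in> range \<iota> then inv \<iota> y
     else child (extend_inverse \<iota> l N (parent y)) (2 * (y + N) + of_bool (l y)))"
  by pat_completeness auto
termination
  by (relation "Wellfounded.measure (\<lambda>(\<iota>, l, N, y). y)") (auto simp: parent_less)

declare extend_inverse.simps [simp del]

text \<open>Labels that give each node infinitely many children with each label, arranged so that they
  are computable.\<close>

definition full_label :: "nat \<Rightarrow> bool" where "full_label y = odd (index y)"

text \<open>Embeddings of the full labelled tree into the tree with labels \<open>l\<close>. The condition on indices ensures
  that a finite initial segment of the universe meets the image only in nodes of bounded index, which
  leaves room for new nodes.\<close>

definition tree_embedding :: "(nat \<Rightarrow> bool) \<Rightarrow> (nat \<Rightarrow> nat) \<Rightarrow> bool" where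
  "tree_embedding l \<iota> \<longleftrightarrow> inj \<iota> \<and> \<iota> 0 = 0 \<and>
    (\<forall>y>0. \<iota> y > 0 \<and> parent (\<iota> y) = \<iota> (parent y) \<and> index y \<le> index (\<iota> y) \<and>
       (l (\<iota> y) \<longleftrightarrow> full_label y))"

lemma tree_embedding_pos: "tree_embedding l \<iota> \<Longrightarrow> \<iota> y > 0 \<longleftrightarrow> y > 0"
  unfolding tree_embedding_def by (cases "y = 0") auto

text \<open>Together these say that the map restricts to an isomorphism from the nodes up to \<open>N\<close>, which are closed
  under taking parents, onto a finite part of the full labelled tree, and that it is the identity on the
  copy of that tree if \<open>\<iota>\<close> is regarded as an inclusion.\<close>

lemma extend_inverse_properties:
  fixes N :: nat
  assumes \<iota>: "tree_embedding l \<iota>"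
  defines "r \<equiv> extend_inverse \<iota> l N"
  shows "r (\<iota> u) = u"
    and "r y > 0 \<longleftrightarrow> y > 0"
    and "y > 0 \<Longrightarrow> parent (r y) = r (parent y)"
    and "y > 0 \<Longrightarrow> full_label (r y) \<longleftrightarrow> l y"
    and "inj_on r {..N}"
proof -
  have inj: "inj \<iota>" and 0: "\<iota> 0 = 0"
    and pos: "\<And>y. y > 0 \<Longrightarrow> parent (\<iota> y) = \<iota> (parent y)"
      "\<And>y. y > 0 \<Longrightarrow> index y \<le> index (\<iota> y)" "\<And>y. y > 0 \<Longrightarrow> l (\<iota> y) \<longleftrightarrow> full_label y"
    using \<iota> by (auto simp: tree_embedding_def)
  show r\<iota>: "r (\<iota> u) = u" for u
  proof (cases "u = 0")
    case False
    then have "\<iota> u \<noteq> 0" using tree_embedding_pos[OF \<iota>, of u] by simp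
    then show ?thesis
      unfolding r_def by (subst extend_inverse.simps) (simp add: inj)
  qed (simp add: r_def 0 extend_inverse.simps)
  have new: "r y = child (r (parent y)) (2 * (y + N) + of_bool (l y))" if "y \<notin> range \<iota>" for y
  proof -
    have "y \<noteq> 0" using that 0 by (metis rangeI)
    with that show ?thesis unfolding r_def by (subst extend_inverse.simps) simp
  qed
  show rpos: "r y > 0 \<longleftrightarrow> y > 0" for y
  proof (cases "y \<in> range \<iota>")
    case True
    then obtain u where "y = \<iota> u" by blast
    then show ?thesis using tree_embedding_pos[OF \<iota>, of u] by (simp add: r\<iota>)
  next
    case False
    moreover have "y \<noteq> 0" using False 0 by (metis rangeI)
    ultimately show ?thesis by (simp add: new)
  qed
  show "parent (r y) = r (parent y)" if "y > 0" for y
  proof (cases "y \<in> range \<iota>")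
    case True
    then obtain u where u: "y = \<iota> u" by blast
    then have "u > 0" using tree_embedding_pos[OF \<iota>, of u] that by simp
    then have "parent y = \<iota> (parent u)" using pos(1) u by simp
    then show ?thesis by (simp add: r\<iota> u)
  qed (simp add: new)
  show "full_label (r y) \<longleftrightarrow> l y" if "y > 0" for y
  proof (cases "y \<in> range \<iota>")
    case True
    then obtain u where u: "y = \<iota> u" by blast
    then have "u > 0" using tree_embedding_pos[OF \<iota>, of u] that by simp
    then show ?thesis using pos(3) u by (simp add: r\<iota>)
  qed (simp add: new full_label_def)
  \<comment> \<open>A new node gets an index of at least \<open>N\<close>, which no node up to \<open>N\<close> of the copy has.\<close>
  have mixed: "r (\<iota> u) \<noteq> r z" if "\<iota> u \<le> N" "z \<notin> range \<iota>" for u z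
  proof
    assume "r (\<iota> u) = r z"
    then have u: "u = child (r (parent z)) (2 * (z + N) + of_bool (l z))"
      using new[OF that(2)] by (simp add: r\<iota>)
    then have "u > 0" "N \<le> index u" by simp_all
    then have "N \<le> index (\<iota> u)" "\<iota> u > 0"
      using pos(2) tree_embedding_pos[OF \<iota>, of u] by (auto intro: le_trans)
    then show False using index_less[of "\<iota> u"] that(1) by simp
  qed
  show "inj_on r {..N}"
  proof (rule inj_onI)
    fix y z assume yz: "y \<in> {..N}" "z \<in> {..N}" "r y = r z"
    show "y = z"
    proof (cases "y \<in> range \<iota>"; cases "z \<in> range \<iota>")
      assume "y \<in> range \<iota>" "z \<in> range \<iota>"
      then show ?thesis using yz(3) r\<iota> by auto
    next
      assume "y \<in> range \<iota>" "z \<notin> range \<iota>"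
      then show ?thesis using mixed yz by auto
    next
      assume "y \<notin> range \<iota>" "z \<in> range \<iota>"
      then show ?thesis using mixed[of _ y] yz by fastforce
    next
      assume "y \<notin> range \<iota>" "z \<notin> range \<iota>"
      then have "2 * (y + N) + of_bool (l y) = 2 * (z + N) + of_bool (l z)"
        using yz(3) new by simp
      moreover have "(2 * a + of_bool b) div 2 = a" for a :: nat and b
        by (cases b) auto
      ultimately have "y + N = z + N" by metis
      then show ?thesis by simp
    qed
  qed
qed

text \<open>Under the pairing function, the numbers that code pairs with first component \<open>0\<close> are the
  triangular numbers. Shifting the first component is therefore an enumeration of the complement
  of a sparse set, and it is computed from pairing and unpairing alone.\<close>

definition dense_code :: "nat \<Rightarrow> nat" where
  "dense_code y = prod_encode (Suc (fst (prod_decode y)), snd (prod_decode y))"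

lemma inj_dense_code: "inj dense_code"
  by (rule injI) (simp add: dense_code_def prod_eq_iff[symmetric])

lemma range_dense_code: "- range dense_code = range triangle"
proof -
  have "prod_encode (m, n) \<in> range dense_code \<longleftrightarrow> m > 0" for m n
  proof
    show "m > 0" if "prod_encode (m, n) \<in> range dense_code"
      using that by (auto simp: dense_code_def)
    show "prod_encode (m, n) \<in> range dense_code" if "m > 0"
      by (rule range_eqI[of _ _ "prod_encode (m - 1, n)"]) (use that in \<open>simp add: dense_code_def\<close>)
  qed
  then have "x \<notin> range dense_code \<longleftrightarrow> fst (prod_decode x) = 0" for x
    by (metis gr0I less_not_refl prod.collapse prod_decode_inverse)
  moreover have "fst (prod_decode x) = 0 \<longleftrightarrow> x \<in> range triangle" for x
  proof
    assume "fst (prod_decode x) = 0"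
    then have "x = prod_encode (0, snd (prod_decode x))"
      by (metis prod.collapse prod_decode_inverse)
    then show "x \<in> range triangle" by (simp add: prod_encode_def)
  next
    assume "x \<in> range triangle"
    then obtain n where "x = prod_encode (0, n)" by (auto simp: prod_encode_def)
    then show "fst (prod_decode x) = 0" by simp
  qed
  ultimately show ?thesis by auto
qed

lemma le_triangle: "k \<le> triangle k" and square_le_triangle: "k * k \<le> 2 * triangle k"
  by (induction k) auto

lemma infinite_compl_range_dense_code: "infinite (- range dense_code)"
  unfolding range_dense_code infinite_nat_iff_unbounded_le using le_triangle by blast

text \<open>Up to \<open>n\<close> there are at most \<open>\<surd>(2n) + 1\<close> triangular numbers.\<close>

lemma dense_range_dense_code: "dense_set (range dense_code)"
proof -
  let ?D = "range dense_code"
  have lower: "1 - (sqrt (2 * real n) + 1) / real (n + 1) \<le> real (card (?D \<inter> {0..n})) / real (n + 1)"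
    for n
  proof -
    have "{0..n} - ?D \<subseteq> triangle ` {..nat \<lfloor>sqrt (2 * real n)\<rfloor>}"
    proof
      fix x assume x: "x \<in> {0..n} - ?D"
      then have "x \<in> - ?D" by simp
      then obtain k where k: "x = triangle k" unfolding range_dense_code by blast
      with x square_le_triangle[of k] have "k * k \<le> 2 * n" by simp
      then have "real k * real k \<le> 2 * real n"
        by (metis of_nat_le_iff of_nat_mult of_nat_numeral)
      then have "real k \<le> sqrt (2 * real n)"
        by (intro real_le_rsqrt) (simp add: power2_eq_square)
      then have "k \<le> nat \<lfloor>sqrt (2 * real n)\<rfloor>" by (simp add: le_nat_floor)
      then show "x \<in> triangle ` {..nat \<lfloor>sqrt (2 * real n)\<rfloor>}" using k by blast
    qed
    then have "card ({0..n} - ?D) \<le> card {..nat \<lfloor>sqrt (2 * real n)\<rfloor>}"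
      by (meson card_image_le card_mono finite_atMost finite_imageI le_trans)
    moreover have "card ({0..n} - ?D) = n + 1 - card (?D \<inter> {0..n})"
      by (subst card_Diff_subset_Int) (auto simp: Int_commute)
    moreover have "real (nat \<lfloor>sqrt (2 * real n)\<rfloor>) \<le> sqrt (2 * real n)" by simp
    ultimately have "real n + 1 - card (?D \<inter> {0..n}) \<le> sqrt (2 * real n) + 1"
      by (simp, linarith)
    then have "real (n + 1) - (sqrt (2 * real n) + 1) \<le> card (?D \<inter> {0..n})" by simp
    then have "(real (n + 1) - (sqrt (2 * real n) + 1)) / real (n + 1)
        \<le> real (card (?D \<inter> {0..n})) / real (n + 1)"
      by (intro divide_right_mono) auto
    then show ?thesis by (simp only: diff_divide_distrib) (simp add: add_eq_0_iff)
  qed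
  have upper: "real (card (?D \<inter> {0..n})) / real (n + 1) \<le> 1" for n
  proof -
    have "card (?D \<inter> {0..n}) \<le> card {0..n}" by (intro card_mono) auto
    then show ?thesis by simp
  qed
  have "(\<lambda>n. 1 - (sqrt (2 * real n) + 1) / real (n + 1)) \<longlonglongrightarrow> 1" by real_asymp
  then show ?thesis
    unfolding dense_set_def
    by (rule tendsto_sandwich[OF _ _ _ tendsto_const, rotated 2]) (use lower upper in auto)
qed

lemma recursive_dense_code: "recursive k f \<Longrightarrow> recursive k (\<lambda>xs. dense_code (f xs))"
  unfolding dense_code_def
  by (intro recursive_prod_encode recursive_Suc recursive_fst_prod_decode recursive_snd_prod_decode)

lemma recursive_distance:
  "recursive k f \<Longrightarrow> recursive k g \<Longrightarrow> recursive k (\<lambda>xs. (f xs - g xs) + (g xs - f xs))"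
  by (intro recursive_add recursive_diff)

lemma ce_set_range_dense_code: "ce_set (range dense_code)"
proof -
  let ?t = "\<lambda>xs. (xs ! 1 - dense_code (xs ! 0)) + (dense_code (xs ! 0) - xs ! 1)"
  have "recursive (Suc 1) ?t"
    by (intro recursive_distance recursive_dense_code recursive_proj) auto
  then have "ce_rel 1 {xs. length xs = 1 \<and> (\<exists>n. ?t (n # xs) = 0)}"
    by (rule ce_rel_projection)
  moreover have "{xs. length xs = 1 \<and> (\<exists>n. ?t (n # xs) = 0)} = (\<lambda>x. [x]) ` range dense_code"
    by (auto simp: length_Suc_conv)
  ultimately show ?thesis unfolding ce_set_def by simp
qed

text \<open>The truncated differences in the test add up to \<open>0\<close> exactly if all required equations hold.\<close>

lemma ce_rel_dense_code_tree:
  "ce_rel 2 {[dense_code y, dense_code (parent y)] | y. y > 0 \<and> (p \<longleftrightarrow> full_label y)}"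
proof -
  let ?y = "\<lambda>xs :: nat list. xs ! 0" and ?u = "\<lambda>xs :: nat list. xs ! 1"
    and ?v = "\<lambda>xs :: nat list. xs ! 2"
  let ?i = "\<lambda>xs. snd (prod_decode (?y xs - Suc 0)) mod 2"
  let ?t = "\<lambda>xs. (1 - ?y xs) + ((?u xs - dense_code (?y xs)) + (dense_code (?y xs) - ?u xs)) +
    ((?v xs - dense_code (fst (prod_decode (?y xs - Suc 0)))) +
     (dense_code (fst (prod_decode (?y xs - Suc 0))) - ?v xs)) +
    ((of_bool p - ?i xs) + (?i xs - of_bool p))"
  have "recursive (Suc 2) ?t"
    by (intro recursive_add recursive_diff recursive_dense_code recursive_mod_2
        recursive_fst_prod_decode recursive_snd_prod_decode recursive_const recursive_proj) auto
  then have "ce_rel 2 {xs. length xs = 2 \<and> (\<exists>n. ?t (n # xs) = 0)}"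
    by (rule ce_rel_projection)
  moreover have "?t [n, u, v] = 0 \<longleftrightarrow> n > 0 \<and> (p \<longleftrightarrow> full_label n) \<and>
      u = dense_code n \<and> v = dense_code (parent n)" for n u v
  proof -
    have eq: "(a - b) + (b - a) = 0 \<longleftrightarrow> a = b" for a b :: nat by auto
    have "of_bool p = index n mod 2 \<longleftrightarrow> (p \<longleftrightarrow> odd (index n))"
      by (cases p) (auto simp: odd_iff_mod_2_eq_one even_iff_mod_2_eq_zero)
    then show ?thesis
      unfolding full_label_def parent_def index_def
      by (auto simp del: add_is_0 simp add: eq add_eq_0_iff_both_eq_0)
  qed
  then have "{xs. length xs = 2 \<and> (\<exists>n. ?t (n # xs) = 0)} =
      {[dense_code y, dense_code (parent y)] | y. y > 0 \<and> (p \<longleftrightarrow> full_label y)}"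
    by (auto simp del: add_is_0 simp add: length_Suc_conv numeral_2_eq_2)
  ultimately show ?thesis by simp
qed

lemma ex_bij_extending:
  fixes f e :: "nat \<Rightarrow> nat"
  assumes "inj f" "inj e" "infinite (- range f)" "infinite (- range e)"
  shows "\<exists>h. bij h \<and> (\<forall>y. h (f y) = e y)"
proof -
  obtain k where k: "bij_betw k (- range f) (- range e)"
    using bij_betw_trans[OF to_nat_on_infinite[OF countableI_type assms(3)]
        bij_betw_from_nat_into[OF countableI_type assms(4)]] by blast
  define h where "h x = (if x \<in> range f then e (inv f x) else k x)" for x
  have "bij_betw h (range f) (range e)"
    by (rule bij_betwI[of _ _ _ "f \<circ> inv e"]) (auto simp: h_def assms(1,2))
  moreover have "bij_betw h (- range f) (- range e)"
    using k by (rule bij_betw_cong[THEN iffD1, rotated]) (simp add: h_def)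
  ultimately have "bij_betw h (range f \<union> - range f) (range e \<union> - range e)"
    by (rule bij_betw_combine) auto
  then have "bij h" by simp
  moreover have "h (f y) = e y" for y by (simp add: h_def assms(1))
  ultimately show ?thesis by blast
qed

text \<open>The copy is obtained by moving the image of \<open>\<iota>\<close> to the set of nontriangular numbers, and everything
  else to the triangular numbers. This needs both complements to be infinite.\<close>

proposition generically_ce_copy_if_tree_embedding:
  assumes \<iota>: "tree_embedding l \<iota>" and inf: "infinite (- range \<iota>)"
  shows "\<exists>B. is_copy tree_lang (tree_struct l) B \<and> Sigma_generically_ce tree_lang 1 B"
proof -
  let ?A = "tree_struct l" and ?D = "range dense_code"
  have inj: "inj \<iota>" using \<iota> by (simp add: tree_embedding_def)
  obtain h where h: "bij h" "\<And>y. h (\<iota> y) = dense_code y"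
    using ex_bij_extending[OF inj inj_dense_code inf infinite_compl_range_dense_code] by blast
  have hinv [simp]: "inv h (h x) = x" "h (inv h x) = x" for x
    using h(1) by (simp_all add: bij_is_inj bij_is_surj surj_f_inv_f)
  have dinv [simp]: "inv h (dense_code y) = \<iota> y" for y
    by (metis h(2) hinv(1))
  define B :: struct where "B = (\<lambda>R xs. fst ?A R (map (inv h) xs), \<lambda>F xs. 0)"
  have B: "fst B R xs \<longleftrightarrow> fst ?A R (map (inv h) xs)" for R xs by (simp add: B_def)
  have "B \<in> structures tree_lang"
    using tree_struct_in_structures[of l] by (auto simp: structures_def B_def tree_lang_def)
  moreover have "isomorphic tree_lang ?A B"
    unfolding isomorphic_def using h(1)
    by (intro exI[of _ h]) (auto simp: B comp_def tree_lang_def)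
  ultimately have copy: "is_copy tree_lang ?A B" by (simp add: is_copy_def)
  have edge: "fst ?A R [\<iota> y, \<iota> z] \<longleftrightarrow> R \<in> {0, 1} \<and> y > 0 \<and> parent y = z \<and> (R = 1 \<longleftrightarrow> full_label y)"
    for R y z
  proof (cases "y > 0")
    case True
    then have "parent (\<iota> y) = \<iota> (parent y)" "l (\<iota> y) \<longleftrightarrow> full_label y"
      using \<iota> by (auto simp: tree_embedding_def)
    then show ?thesis
      using True inj tree_embedding_pos[OF \<iota>, of y] by (auto simp: tree_struct_pair inj_eq)
  qed (use tree_embedding_pos[OF \<iota>, of y] in \<open>simp add: tree_struct_pair\<close>)
  have "{xs. length xs = 2 \<and> set xs \<subseteq> ?D \<and> fst B R xs} =
      {[dense_code y, dense_code (parent y)] | y. y > 0 \<and> ((R = 1) \<longleftrightarrow> full_label y)}"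
    if "R \<in> {0, 1}" for R
  proof -
    have "xs \<in> {xs. length xs = 2 \<and> set xs \<subseteq> ?D \<and> fst B R xs} \<longleftrightarrow>
        (\<exists>y z. xs = [dense_code y, dense_code z] \<and> fst B R xs)" for xs
      by (auto simp: length_Suc_conv numeral_2_eq_2)
    then show ?thesis using that by (auto simp: B edge)
  qed
  then have ce: "ce_substructure tree_lang B ?D"
    using ce_rel_dense_code_tree ce_set_range_dense_code
    by (simp add: ce_substructure_def substructure_on_def tree_lang_def)
  have elem: "Sigma_elementary tree_lang 1 B ?D"
  proof (rule Sigma_elementary_1_if_finite_embeddings)
    fix X :: "nat set" assume "finite X"
    then obtain N where N: "inv h ` X \<subseteq> {..N}"
      using finite_nat_iff_bounded_le by blast
    define r where "r = extend_inverse \<iota> l N"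
    note r = extend_inverse_properties[OF \<iota>, where N = N, folded r_def]
    \<comment> \<open>The finite embedding is carried over from the tree to its copy by \<open>h\<close>.\<close>
    define q where "q x = dense_code (r (inv h x))" for x
    have "inj_on q X"
    proof (rule inj_onI)
      fix x y assume xy: "x \<in> X" "y \<in> X" "q x = q y"
      then have "r (inv h x) = r (inv h y)" by (simp add: q_def inj_eq[OF inj_dense_code])
      then have "inv h x = inv h y" by (rule inj_onD[OF r(5)]) (use N xy(1,2) in auto)
      then show "x = y" by (metis hinv(2))
    qed
    moreover have "q x = x" if "x \<in> ?D" for x
      using that r(1) by (auto simp: q_def)
    moreover have "fst B R (map q xs) \<longleftrightarrow> fst B R xs"
      if len: "length xs = 2" and X: "set xs \<subseteq> X" for R xs
    proof -
      obtain x y where xs: "xs = [x, y]" using len by (auto simp: length_Suc_conv numeral_2_eq_2)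
      let ?x = "inv h x" and ?y = "inv h y"
      from X N xs have le: "?x \<le> N" "?y \<le> N" by auto
      then have "parent ?x \<le> N" if "?x > 0" using parent_less[OF that] by simp
      then have eq: "r (parent ?x) = r ?y \<longleftrightarrow> parent ?x = ?y" if "?x > 0"
        using that le r(5) by (auto simp: inj_on_eq_iff)
      have "fst B R (map q xs) \<longleftrightarrow>
          R \<in> {0, 1} \<and> r ?x > 0 \<and> parent (r ?x) = r ?y \<and> (R = 1 \<longleftrightarrow> full_label (r ?x))"
        by (simp add: xs B q_def edge)
      also have "\<dots> \<longleftrightarrow> R \<in> {0, 1} \<and> ?x > 0 \<and> parent ?x = ?y \<and> (R = 1 \<longleftrightarrow> l ?x)"
        by (cases "?x > 0") (simp_all add: r(2-4) eq)
      also have "\<dots> \<longleftrightarrow> fst B R xs" by (simp add: xs B tree_struct_pair)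
      finally show ?thesis .
    qed
    ultimately show "\<exists>r. inj_on r X \<and> r ` X \<subseteq> ?D \<and> (\<forall>x\<in>X \<inter> ?D. r x = x) \<and>
      (\<forall>R\<in>rels tree_lang. \<forall>xs. length xs = rel_arity tree_lang R \<longrightarrow> set xs \<subseteq> X \<longrightarrow>
        (fst B R (map r xs) \<longleftrightarrow> fst B R xs))"
      by (intro exI[of _ q]) (auto simp: tree_lang_def q_def)
  qed (simp_all add: tree_lang_def)
  have "Sigma_generically_ce tree_lang 1 B"
    unfolding Sigma_generically_ce_def using dense_range_dense_code ce elem by blast
  with copy show ?thesis by blast
qed

section \<open>Coding an analytic set\<close>

text \<open>An index codes two numbers. The first one is a step of the branch on which the node lies; the
  second one is left free, and its parity serves as the label of a good node. In this way each
  step can be made with both labels and in infinitely many ways.\<close>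

function steps :: "nat \<Rightarrow> nat list" where
  "steps y = (if y = 0 then [] else steps (parent y) @ [fst (prod_decode (index y))])"
  by pat_completeness auto
termination by (relation "Wellfounded.measure id") (auto simp: parent_less)

declare steps.simps [simp del]

lemma steps_0 [simp]: "steps 0 = []"
  by (simp add: steps.simps)

lemma steps_pos: "y > 0 \<Longrightarrow> steps y = steps (parent y) @ [fst (prod_decode (index y))]"
  by (subst steps.simps) simp

text \<open>Membership in the tree whose infinite branches are the sections of the closed set \<open>C\<close> at \<open>x\<close>.\<close>

definition agrees :: "((nat \<Rightarrow> nat) \<times> (nat \<Rightarrow> nat)) set \<Rightarrow> (nat \<Rightarrow> nat) \<Rightarrow> nat list \<Rightarrow> bool" where
  "agrees C x t \<longleftrightarrow> (\<exists>u v. (u, v) \<in> C \<and> (\<forall>i<length t. u i = x i \<and> v i = t ! i))"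

lemma agrees_prefix:
  assumes "agrees C x (t @ t')"
  shows "agrees C x t"
proof -
  obtain u v where "(u, v) \<in> C" and *: "\<forall>i<length (t @ t'). u i = x i \<and> v i = (t @ t') ! i"
    using assms unfolding agrees_def by blast
  moreover have "u i = x i \<and> v i = t ! i" if "i < length t" for i
    using *[rule_format, of i] that by (simp add: nth_append)
  ultimately show ?thesis unfolding agrees_def by blast
qed

lemma tendsto_coordinatewise_UNIV:
  fixes f :: "'a \<Rightarrow> 'i \<Rightarrow> 'b::topological_space"
  assumes "\<And>i. ((\<lambda>n. f n i) \<longlongrightarrow> l i) F"
  shows "(f \<longlongrightarrow> l) F"
proof -
  have "limitin (product_topology (\<lambda>_. euclidean) UNIV) f l F"
    unfolding limitin_componentwise using assms by simp
  then show ?thesis by (simp add: euclidean_product_topology)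
qed

lemma in_closed_iff_agrees:
  assumes "closed C"
  shows "(x, g) \<in> C \<longleftrightarrow> (\<forall>n. agrees C x (map g [0..<n]))"
proof
  show "\<forall>n. agrees C x (map g [0..<n])" if "(x, g) \<in> C"
    using that unfolding agrees_def by auto
next
  assume *: "\<forall>n. agrees C x (map g [0..<n])"
  have "\<exists>p. p \<in> C \<and> (\<forall>i<n. fst p i = x i \<and> snd p i = g i)" for n
  proof -
    obtain u v where "(u, v) \<in> C" "\<forall>i<n. u i = x i \<and> v i = g i"
      using *[rule_format, of n] unfolding agrees_def by auto
    then show ?thesis by (intro exI[of _ "(u, v)"]) simp
  qed
  then obtain p where p: "\<And>n. p n \<in> C" "\<And>n i. i < n \<Longrightarrow> fst (p n) i = x i"
    "\<And>n i. i < n \<Longrightarrow> snd (p n) i = g i" by metis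
  have conv: "f \<longlonglongrightarrow> l" if "\<And>n i. i < n \<Longrightarrow> f n i = l i" for f :: "nat \<Rightarrow> nat \<Rightarrow> nat" and l
  proof (rule tendsto_coordinatewise_UNIV)
    show "(\<lambda>n. f n i) \<longlonglongrightarrow> l i" for i
      by (rule tendsto_eventually, rule eventually_sequentiallyI[of "Suc i"]) (simp add: that)
  qed
  have "(\<lambda>n. (fst (p n), snd (p n))) \<longlonglongrightarrow> (x, g)"
    by (intro tendsto_Pair conv p(2,3))
  then have "p \<longlonglongrightarrow> (x, g)" by simp
  then show "(x, g) \<in> C"
    using assms p(1) closed_sequentially by blast
qed

text \<open>The first case of the definition is that of a good node. A label depends on \<open>x\<close> only
  up to the depth of the node, which makes the coding continuous in \<open>x\<close>.\<close>

definition code_label ::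
  "nat set \<Rightarrow> ((nat \<Rightarrow> nat) \<times> (nat \<Rightarrow> nat)) set \<Rightarrow> (nat \<Rightarrow> nat) \<Rightarrow> nat \<Rightarrow> bool" where
  "code_label X C x y \<longleftrightarrow> (if agrees C x (steps y) then odd (snd (prod_decode (index y)))
     else length (steps y) \<in> X)"

lemma continuous_tree_struct_code_label:
  "continuous_on UNIV (\<lambda>x. tree_struct (code_label X C x))"
proof -
  have label: "code_label X C x y = code_label X C x' y" if "\<And>i. i < length (steps y) \<Longrightarrow> x i = x' i" for x x' y
  proof -
    have "agrees C x (steps y) = agrees C x' (steps y)"
      using that unfolding agrees_def by (simp cong: conj_cong)
    then show ?thesis by (simp add: code_label_def)
  qed
  have "fst (tree_struct (code_label X C x)) R xs = fst (tree_struct (code_label X C x')) R xs"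
    if "\<And>i. i < length (steps (hd xs)) \<Longrightarrow> x i = x' i" for x x' R xs
  proof (cases xs)
    case (Cons y ys)
    with that have "code_label X C x y = code_label X C x' y" by (intro label) simp
    with Cons show ?thesis by (simp add: tree_struct_def)
  qed (simp add: tree_struct_def)
  then have "continuous_on UNIV (\<lambda>x. fst (tree_struct (code_label X C x)) R xs)" for R xs
    by (rule continuous_if_prefix_determined)
  then show ?thesis
    unfolding tree_struct_def fst_conv
    by (intro continuous_on_Pair continuous_on_coordinatewise_then_product continuous_on_const)
qed

text \<open>The nodes whose steps follow \<open>g\<close>, parametrized by the full labelled tree: the steps are
  prescribed by \<open>g\<close> and the free components of the indices range over all numbers.\<close>

function path_copy :: "(nat \<Rightarrow> nat) \<Rightarrow> nat \<Rightarrow> nat" where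
  "path_copy g y = (if y = 0 then 0 else
     child (path_copy g (parent y)) (prod_encode (g (length (steps (parent y))), index y)))"
  by pat_completeness auto
termination by (relation "Wellfounded.measure snd") (auto simp: parent_less)

declare path_copy.simps [simp del]

lemma path_copy_0: "path_copy g 0 = 0"
  by (simp add: path_copy.simps)

lemma path_copy_pos:
  assumes "y > 0"
  shows "path_copy g y > 0" and "parent (path_copy g y) = path_copy g (parent y)"
    and "index (path_copy g y) = prod_encode (g (length (steps (parent y))), index y)"
  using assms by (simp_all add: path_copy.simps[of g y])

lemma steps_path_copy: "steps (path_copy g y) = map g [0..<length (steps y)]"
proof (induction y rule: less_induct)
  case (less y)
  show ?case
  proof (cases "y > 0")
    case True
    then show ?thesis
      using less[OF parent_less[OF True]]
      by (simp add: steps_pos[of y] steps_pos[of "path_copy g y"] path_copy_pos)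
  qed (simp add: path_copy_0)
qed

lemma inj_path_copy: "inj (path_copy g)"
proof (rule injI)
  show "path_copy g y = path_copy g z \<Longrightarrow> y = z" for y z
  proof (induction y arbitrary: z rule: less_induct)
    case (less y)
    show ?case
    proof (cases "y > 0")
      case True
      then have z: "z > 0" using less.prems path_copy_pos(1)[of y g] path_copy_0[of g]
        by (cases "z = 0") auto
      have "path_copy g (parent y) = path_copy g (parent z)"
        using path_copy_pos(2)[OF True] path_copy_pos(2)[OF z] less.prems by metis
      then have "parent y = parent z" using less.IH parent_less[OF True] by blast
      moreover have "index y = index z"
        using path_copy_pos(3)[OF True, of g] path_copy_pos(3)[OF z, of g] less.prems by simp
      ultimately show ?thesis using child_parent_index True z by metis
    next
      case False
      then show ?thesis
        using less.prems path_copy_pos(1)[of z g] path_copy_0[of g] by (cases "z > 0") auto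
    qed
  qed
qed

text \<open>Children of the root that leave \<open>g\<close> in the first step are missed.\<close>

lemma infinite_compl_range_path_copy: "infinite (- range (path_copy g))"
proof -
  have "child 0 (prod_encode (Suc (g 0), i)) \<notin> range (path_copy g)" for i
  proof
    assume "child 0 (prod_encode (Suc (g 0), i)) \<in> range (path_copy g)"
    then obtain y where y: "path_copy g y = child 0 (prod_encode (Suc (g 0), i))" by force
    then have pos: "y > 0" using path_copy_0[of g] by (metis child_pos gr0I less_not_refl)
    have "path_copy g (parent y) = 0"
      using path_copy_pos(2)[OF pos, of g] y by simp
    then have "parent y = 0" using path_copy_pos(1)[of "parent y" g] by (cases "parent y > 0") auto
    then show False using path_copy_pos(3)[OF pos, of g] y by simp
  qed
  then have "range (\<lambda>i. child 0 (prod_encode (Suc (g 0), i))) \<subseteq> - range (path_copy g)"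
    by (intro image_subsetI) simp
  moreover have "infinite (range (\<lambda>i. child 0 (prod_encode (Suc (g 0), i))))"
    by (intro range_inj_infinite injI) simp
  ultimately show ?thesis using finite_subset by blast
qed

lemma tree_embedding_path_copy:
  assumes "\<And>n. agrees C x (map g [0..<n])"
  shows "tree_embedding (code_label X C x) (path_copy g)"
  unfolding tree_embedding_def
  using assms
  by (auto simp: inj_path_copy path_copy_0 path_copy_pos le_prod_encode_2 code_label_def
      steps_path_copy full_label_def)

text \<open>The chain may start anywhere in the tree: the steps leading to its first node become the
  beginning of the path.\<close>

lemma path_of_infinite_branch:
  assumes w: "\<And>n. w (Suc n) > 0" "\<And>n. parent (w (Suc n)) = w n"
    and good: "\<And>n. agrees C x (steps (w n))"
  shows "\<exists>g. \<forall>n. agrees C x (map g [0..<n])"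
proof -
  have step: "steps (w (Suc n)) = steps (w n) @ [fst (prod_decode (index (w (Suc n))))]" for n
    using steps_pos[OF w(1)] w(2) by simp
  have len: "length (steps (w n)) = length (steps (w 0)) + n" for n
    by (induction n) (simp_all add: step)
  have later: "steps (w (n + k)) ! i = steps (w n) ! i" if "i < length (steps (w n))" for n k i
  proof (induction k)
    case (Suc k)
    have "i < length (steps (w (n + k)))" using that len[of n] len[of "n + k"] by simp
    then show ?case using Suc by (simp add: step nth_append)
  qed simp
  define g where "g i = steps (w (Suc i)) ! i" for i
  have "agrees C x (map g [0..<n])" for n
  proof -
    have "take n (steps (w n)) = map g [0..<n]"
    proof (rule nth_equalityI)
      show "length (take n (steps (w n))) = length (map g [0..<n])" using len[of n] by simp
      fix i assume "i < length (take n (steps (w n)))"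
      then have i: "i < n" by simp
      then have "steps (w (Suc i + (n - Suc i))) ! i = steps (w (Suc i)) ! i"
        by (intro later) (simp add: len[of "Suc i"])
      with i show "take n (steps (w n)) ! i = map g [0..<n] ! i" by (simp add: g_def)
    qed
    moreover have "agrees C x (take n (steps (w n)))"
      using good[of n] agrees_prefix[of C x "take n (steps (w n))" "drop n (steps (w n))"] by simp
    ultimately show ?thesis by simp
  qed
  then show ?thesis by blast
qed

text \<open>Diagonalization. A number coding a pair with first component \<open>i\<close> is reserved for the index \<open>i\<close>; the one
  with second component \<open>k i\<close> is large enough to be of the form \<open>k i + n\<close>.\<close>

lemma ex_set_avoiding_countable_family:
  fixes Z :: "'i::countable \<Rightarrow> nat set" and k :: "'i \<Rightarrow> nat"
  shows "\<exists>X. \<forall>i. \<exists>n. n \<in> Z i \<longleftrightarrow> k i + n \<notin> X"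
proof -
  define X where "X = {m. m - snd (prod_decode m) \<notin> Z (from_nat (fst (prod_decode m)))}"
  have "\<exists>n. n \<in> Z i \<longleftrightarrow> k i + n \<notin> X" for i
  proof
    let ?m = "prod_encode (to_nat i, k i)"
    have "k i + (?m - k i) = ?m" using le_prod_encode_2[of "k i" "to_nat i"] by simp
    then show "?m - k i \<in> Z i \<longleftrightarrow> k i + (?m - k i) \<notin> X" by (simp add: X_def)
  qed
  then show ?thesis by blast
qed

definition computed_relation :: "recf \<Rightarrow> (nat \<times> nat) set" where
  "computed_relation f = {(y, z). \<exists>v. computes f [y, z] v}"

text \<open>Here \<open>S0\<close> and \<open>S1\<close> are the relations between a child and its parent for the two labels. A number \<open>n\<close>
  belongs to the set if some node \<open>n + 1\<close> levels below \<open>b\<close> has label \<open>1\<close>. Starting one level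
  below avoids the label of \<open>b\<close> itself.\<close>

definition labels_below :: "(nat \<times> nat) set \<Rightarrow> (nat \<times> nat) set \<Rightarrow> nat \<Rightarrow> nat set" where
  "labels_below S0 S1 b = {n. \<exists>y. (y, b) \<in> S1 O (S0 \<union> S1) ^^ n}"

text \<open>Having a child is expressed by an existential formula with the parent as parameter.\<close>

lemma Sigma_elementary_child:
  assumes elem: "Sigma_elementary tree_lang 1 B D" and z: "z \<in> D"
    and R: "R \<in> {0, 1}" "fst B R [y, z]"
  shows "\<exists>y'\<in>D. fst B 0 [y', z] \<or> fst B 1 [y', z]"
proof -
  let ?\<psi> = "Or (Rel 0 [Var 0, Var 1]) (Rel 1 [Var 0, Var 1])"
  let ?\<phi> = "Disj {0} (\<lambda>_. foldr Ex [0] ?\<psi>)"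
  have "Sigma_fm 1 ?\<phi>"
    unfolding Sigma_fm_1_iff by (blast intro: quantifier_free.intros)
  moreover have "wf_fm tree_lang ?\<phi>" by (simp add: tree_lang_def)
  moreover have "finite (fv ?\<phi>)" "(\<lambda>_. z) ` fv ?\<phi> \<subseteq> D" using z by auto
  moreover have "sat B UNIV (\<lambda>_. z) ?\<phi>" using R by auto
  ultimately have "sat B D (\<lambda>_. z) ?\<phi>" using elem unfolding Sigma_elementary_def by blast
  then show ?thesis by simp
qed

text \<open>Either the substructure contains good nodes only and, being closed under taking some child,
  it contains an infinite branch; or it contains a bad node, and then the set \<open>labels_below\<close> that
  the c.e. relations of the substructure define at this node is a shift of \<open>X\<close>.\<close>

proposition path_if_generically_ce_copy:
  assumes X: "\<And>f0 f1 b k. \<exists>n. n \<in> labels_below (computed_relation f0) (computed_relation f1) b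
      \<longleftrightarrow> Suc k + n \<notin> X"
    and copy: "is_copy tree_lang (tree_struct (code_label X C x)) B"
    and gen: "Sigma_generically_ce tree_lang 1 B"
  shows "\<exists>g. \<forall>n. agrees C x (map g [0..<n])"
proof -
  let ?l = "code_label X C x"
  obtain D where ce: "ce_substructure tree_lang B D" and elem: "Sigma_elementary tree_lang 1 B D"
    using gen unfolding Sigma_generically_ce_def by blast
  obtain h where h: "bij h" and iso: "\<And>R xs. R \<in> {0, 1} \<Longrightarrow> length xs = 2 \<Longrightarrow>
      fst (tree_struct ?l) R xs \<longleftrightarrow> fst B R (map h xs)"
    using copy unfolding is_copy_def isomorphic_def by (auto simp: tree_lang_def)
  have edge: "fst B R [h y, h z] \<longleftrightarrow> y > 0 \<and> parent y = z \<and> (R = 1 \<longleftrightarrow> ?l y)" if "R \<in> {0, 1}" for R y z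
    using iso[of R "[y, z]"] that by (simp add: tree_struct_pair)
  define D0 where "D0 = h -` D"
  have "D \<noteq> {}" using ce by (simp add: ce_substructure_def substructure_on_def)
  then obtain w0 where w0: "w0 \<in> D0"
    using bij_is_surj[OF h] unfolding D0_def by (metis equals0I surjD vimageI2)
  \<comment> \<open>In the whole tree the node \<open>child z 0\<close> is a witness, whatever its label.\<close>
  have child: "\<exists>y\<in>D0. y > 0 \<and> parent y = z" if "z \<in> D0" for z
  proof -
    have "fst B (of_bool (?l (child z 0))) [h (child z 0), h z]" by (simp add: edge)
    then have "\<exists>y'\<in>D. fst B 0 [y', h z] \<or> fst B 1 [y', h z]"
      by (rule Sigma_elementary_child[OF elem, rotated 2]) (use that in \<open>auto simp: D0_def\<close>)
    then obtain y' where "y' \<in> D" "fst B 0 [y', h z] \<or> fst B 1 [y', h z]" by blast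
    moreover obtain y where "y' = h y" using bij_is_surj[OF h] by blast
    ultimately show ?thesis by (auto simp: edge D0_def)
  qed
  have "\<forall>w\<in>D0. agrees C x (steps w)"
  proof (rule ccontr)
    assume "\<not> (\<forall>w\<in>D0. agrees C x (steps w))"
    then obtain w where w: "w \<in> D0" "\<not> agrees C x (steps w)" by blast
    define S where "S R = {(y, z). y \<in> D \<and> z \<in> D \<and> fst B R [y, z]}" for R
    have S_computed: "\<exists>f. S R = computed_relation f" if "R \<in> {0, 1}" for R
    proof -
      have "ce_rel 2 {xs. length xs = 2 \<and> set xs \<subseteq> D \<and> fst B R xs}"
        using ce that by (auto simp: ce_substructure_def tree_lang_def)
      then obtain f where f: "{xs. length xs = 2 \<and> set xs \<subseteq> D \<and> fst B R xs} =
          {xs. length xs = 2 \<and> (\<exists>y. computes f xs y)}"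
        unfolding ce_rel_def by blast
      have "(y, z) \<in> S R \<longleftrightarrow> (y, z) \<in> computed_relation f" for y z
      proof -
        have "[y, z] \<in> {xs. length xs = 2 \<and> set xs \<subseteq> D \<and> fst B R xs} \<longleftrightarrow>
            [y, z] \<in> {xs. length xs = 2 \<and> (\<exists>y. computes f xs y)}" unfolding f ..
        then show ?thesis by (simp add: S_def computed_relation_def)
      qed
      then show ?thesis by auto
    qed
    obtain f0 where f0: "S 0 = computed_relation f0" using S_computed[of 0] by auto
    obtain f1 where f1: "S 1 = computed_relation f1" using S_computed[of 1] by auto
    let ?T = "S 0 \<union> S 1"
    have S_iff: "(h y, h z) \<in> S R \<longleftrightarrow> y \<in> D0 \<and> z \<in> D0 \<and> y > 0 \<and> parent y = z \<and> (R = 1 \<longleftrightarrow> ?l y)"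
      if "R \<in> {0, 1}" for R y z
      using that by (auto simp: S_def edge D0_def)
    have bad: "\<not> agrees C x (steps y)" "length (steps y) = Suc (length (steps z))"
      if "y > 0" "parent y = z" "\<not> agrees C x (steps z)" for y z
      using that agrees_prefix by (auto simp: steps_pos)
    have below: "\<exists>z\<in>D0. v = h z \<and> \<not> agrees C x (steps z) \<and> length (steps z) = length (steps w) + n"
      if "(v, h w) \<in> ?T ^^ n" for v n
      using that
    proof (induction n arbitrary: v)
      case 0
      then show ?case using w by auto
    next
      case (Suc n)
      then obtain v' where v': "(v, v') \<in> ?T" "(v', h w) \<in> ?T ^^ n"
        by (meson relpow_Suc_E2)
      obtain z where z: "z \<in> D0" "v' = h z" "\<not> agrees C x (steps z)"
        "length (steps z) = length (steps w) + n"
        using Suc.IH[OF v'(2)] by blast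
      obtain y where y: "v = h y" using bij_is_surj[OF h] by blast
      have "y \<in> D0 \<and> y > 0 \<and> parent y = z"
        using v'(1) S_iff[of 0 y z] S_iff[of 1 y z] unfolding y z(2) by auto
      then show ?case using bad[of y z] z(3,4) y by auto
    qed
    have reach: "\<exists>z\<in>D0. (h z, h w) \<in> ?T ^^ n" for n
    proof (induction n)
      case 0
      then show ?case using w by auto
    next
      case (Suc n)
      then obtain z where z: "z \<in> D0" "(h z, h w) \<in> ?T ^^ n" by blast
      obtain y where y: "y \<in> D0" "y > 0" "parent y = z" using child[OF z(1)] by blast
      then have "(h y, h z) \<in> ?T"
        using z(1) S_iff[of 0 y z] S_iff[of 1 y z] by auto
      from relpow_Suc_I2[OF this z(2)] show ?case using y(1) by blast
    qed
    \<comment> \<open>All descendants of \<open>w\<close> are bad, so their labels are dictated by \<open>X\<close>.\<close>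
    have "n \<in> labels_below (S 0) (S 1) (h w) \<longleftrightarrow> Suc (length (steps w)) + n \<in> X" for n
    proof
      assume "n \<in> labels_below (S 0) (S 1) (h w)"
      then obtain v u where vu: "(v, u) \<in> S 1" "(u, h w) \<in> ?T ^^ n"
        unfolding labels_below_def by blast
      obtain z where z: "u = h z" "\<not> agrees C x (steps z)" "length (steps z) = length (steps w) + n"
        using below[OF vu(2)] by blast
      obtain y where y: "v = h y" using bij_is_surj[OF h] by blast
      have "y > 0" "parent y = z" "?l y" using vu(1) S_iff[of 1 y z] unfolding y z(1) by auto
      then show "Suc (length (steps w)) + n \<in> X"
        using bad[of y z] z(2,3) by (auto simp: code_label_def)
    next
      assume nX: "Suc (length (steps w)) + n \<in> X"
      obtain z where z: "z \<in> D0" "(h z, h w) \<in> ?T ^^ n" using reach by blast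
      then have zbad: "\<not> agrees C x (steps z)" "length (steps z) = length (steps w) + n"
        using below[OF z(2)] bij_is_inj[OF h] by (auto simp: inj_eq)
      obtain y where y: "y \<in> D0" "y > 0" "parent y = z" using child[OF z(1)] by blast
      then have "?l y" using bad[of y z] zbad nX by (auto simp: code_label_def)
      then have "(h y, h z) \<in> S 1" using S_iff[of 1 y z] y z(1) by simp
      then show "n \<in> labels_below (S 0) (S 1) (h w)"
        unfolding labels_below_def using z(2) by blast
    qed
    then show False using X[of f0 f1 "h w" "length (steps w)"] unfolding f0 f1 by blast
  qed
  moreover obtain w where "w 0 = w0" and w: "\<And>n. w n \<in> D0"
    "\<And>n. w (Suc n) > 0 \<and> parent (w (Suc n)) = w n"
    using dependent_nat_choice[of "\<lambda>n z. z \<in> D0 \<and> (n = 0 \<longrightarrow> z = w0)" "\<lambda>n z y. y > 0 \<and> parent y = z"]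
      w0 child by (metis nat.distinct(1))
  ultimately show ?thesis
    by (intro path_of_infinite_branch[of w]) auto
qed

theorem theorem1p6:
  shows "\<exists>(L::language) (K::struct set).
    Pi_axiomatizable L 2 K \<and>
    Sigma11_complete_within K {A \<in> K. \<exists>B. is_copy L A B \<and> Sigma_generically_ce L 1 B}"
proof (intro exI conjI)
  show "Pi_axiomatizable tree_lang 2 (structures tree_lang)"
    unfolding Pi_axiomatizable_def by (rule exI[of _ "{}"]) simp
  let ?K = "structures tree_lang"
  let ?S = "{A \<in> ?K. \<exists>B. is_copy tree_lang A B \<and> Sigma_generically_ce tree_lang 1 B}"
  let ?Z = "\<lambda>(f0, f1, b, k). labels_below (computed_relation f0) (computed_relation f1) b"
  obtain X where X': "\<forall>i. \<exists>n. n \<in> ?Z i \<longleftrightarrow> (case i of (f0, f1, b, k) \<Rightarrow> Suc k) + n \<notin> X"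
    using ex_set_avoiding_countable_family[of ?Z "\<lambda>(f0, f1, b, k). Suc k"] by (rule exE)
  have X: "\<exists>n. n \<in> labels_below (computed_relation f0) (computed_relation f1) b
      \<longleftrightarrow> Suc k + n \<notin> X" for f0 f1 b k
    using spec[OF X', of "(f0, f1, b, k)"] by (simp only: split)
  have "\<exists>F. continuous_on UNIV F \<and> range F \<subseteq> ?K \<and> (\<forall>x. x \<in> P \<longleftrightarrow> F x \<in> ?S)"
    if P: "analytic_set P" for P :: "(nat \<Rightarrow> nat) set"
  proof -
    obtain C :: "((nat \<Rightarrow> nat) \<times> (nat \<Rightarrow> nat)) set" where C: "closed C" "P = fst ` C"
      using P unfolding analytic_set_def by blast
    let ?F = "\<lambda>x. tree_struct (code_label X C x)"
    have path: "x \<in> P \<longleftrightarrow> (\<exists>g. \<forall>n. agrees C x (map g [0..<n]))" for x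
      unfolding C(2) in_closed_iff_agrees[OF C(1), symmetric] by force
    have "x \<in> P \<longleftrightarrow> ?F x \<in> ?S" for x
    proof
      assume "x \<in> P"
      then obtain g where "\<And>n. agrees C x (map g [0..<n])" using path by blast
      then show "?F x \<in> ?S"
        using generically_ce_copy_if_tree_embedding[OF tree_embedding_path_copy
            infinite_compl_range_path_copy] tree_struct_in_structures by blast
    next
      assume "?F x \<in> ?S"
      then show "x \<in> P" unfolding path using path_if_generically_ce_copy[OF X] by blast
    qed
    then show ?thesis
      using continuous_tree_struct_code_label tree_struct_in_structures
      by (intro exI[of _ ?F]) blast
  qed
  then show "Sigma11_complete_within ?K ?S"
    unfolding Sigma11_complete_within_def using analytic_generically_ce_copy by blast
qed

end
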